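(* Let $(X,d)$ be a metric space, $\mu$ a non-atomic Borel measure on $X$, $m$ a doubling Borel measure on $X$, $1\le p<\infty$, $0<\beta\le1$, and let $\Gamma^*\subset\Gamma^\mu$ be a family of paths closed under taking non-trivial subpaths such that any two points of $X$ are joined by a path in $\Gamma^*$. Assume that $X$ supports a $(1,p)$-Poincaré inequality of exponent $\beta$ and that $\Gamma^*$ has the $\mu$-arc-chord property with exponent $\beta$. Then Lipschitz-$\beta$ functions are dense in $N^{1,p}$: for every $f\in\tilde N^{1,p}$ and every $\varepsilon>0$ there is a function $u\in\tilde N^{1,p}$ satisfying $|u(x)-u(y)|\le L\,d(x,y)^\beta$ for all $x,y\in X$ (for some $L<\infty$) with $\|f-u\|_{N^{1,p}}<\varepsilon$.
   Context: A path is a continuous map $\gamma:[a,b]\to X$; a subpath is a restriction of $\gamma$ to a subinterval, trivial if that interval is a point; $\mathrm{Im}(\gamma)=\gamma([a,b])$. $\mu$ non-atomic means $\mu(\{x\})=0$ for all $x$. $\Gamma^\mu$ is the set of all non-trivial injective paths $\gamma$ such that $0<\mu(\mathrm{Im}(\tilde\gamma))<\infty$ for every non-trivial subpath $\tilde\gamma$ of $\gamma$. For Borel $g\ge0$, $\int_\gamma g:=\int_{\mathrm{Im}(\gamma)}g\,d\mu$. A Borel $\rho:X\to[0,\infty]$ is an upper gradient of $f$ (in a set $A$) if $|f(x)-f(y)|\le\int_\gamma\rho$ for every $\gamma\in\Gamma^*$ (with image in $A$) whose endpoints $x,y$ satisfy $f(x),f(y)$ finite. For $\Gamma\subset\Gamma^*$,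 $\mathrm{Mod}_p(\Gamma)=\inf\int_Xg^p\,dm$ over Borel $g\ge0$ with $\int_\gamma g\ge1$ for all $\gamma\in\Gamma$; "$p$-almost every path" means outside a family of $p$-modulus zero. $\rho$ is a $p$-weak upper gradient of $f$ if the upper gradient inequality holds for $p$-almost every $\gamma\in\Gamma^*$. $\tilde N^{1,p}$ is the set of $f\in L^p(m)$ having a $p$-weak upper gradient in $L^p(m)$, with $\|f\|_{N^{1,p}}=\|f\|_{L^p(m)}+\inf_\rho\|\rho\|_{L^p(m)}$ (infimum over $p$-weak upper gradients); $N^{1,p}=\tilde N^{1,p}/\!\sim$ where $f\sim g\iff\|f-g\|_{N^{1,p}}=0$. $m$ is doubling if $0<m(B(x,2r))\le C\,m(B(x,r))<\infty$ for all balls. $X$ supports a $(1,p)$-Poincaré inequality of exponent $\beta$ if there are $C>0$, $\lambda\ge1$ such that for every ball $B$ and every pair $f,\rho$ with $f\in L^1(B)$ and $\rho$ an upper gradient of $f$ in $B$: $\frac{1}{m(B)}\int_B|f-f_B|\,dm\le C\,\mathrm{diam}(B)^\beta\big(\frac{1}{m(\lambda B)}\int_{\lambda B}\rho^p\,dm\big)^{1/p}$, where $f_B=\frac1{m(B)}\int_Bf\,dm$. $\Gamma^*$ has the $\mu$-arc-chord property with exponent $\beta$ if there is $C_\mu>0$ with $\mathrm{diam}(\mathrm{Im}(\gamma))^\beta\le C_\mu\,\mu(\mathrm{Im}(\gamma))$ for every $\gamma\in\Gamma^*$. *)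

theory Defs
  imports "HOL-Analysis.Analysis"
begin

definition enn_powr :: "ennreal \<Rightarrow> real \<Rightarrow> ennreal" where
  "enn_powr x q = (if x = \<infinity> then \<infinity> else ennreal (enn2real x powr q))"

definition epow :: "ereal \<Rightarrow> real \<Rightarrow> ennreal" where
  "epow v q = enn_powr (e2ennreal \<bar>v\<bar>) q"

text \<open>Restriction of a path on [0,1] to the subinterval [u,v], affinely reparametrised to [0,1]
  (same formula as the library's subpath, which requires a vector space).\<close>
definition subpath' :: "real \<Rightarrow> real \<Rightarrow> (real \<Rightarrow> 'a) \<Rightarrow> real \<Rightarrow> 'a" where
  "subpath' u v g = (\<lambda>t. g ((v - u) * t + u))"

definition line_int :: "'a::metric_space measure \<Rightarrow> ('a \<Rightarrow> ennreal) \<Rightarrow> (real \<Rightarrow> 'a) \<Rightarrow> ennreal" where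
  "line_int mu g \<gamma> = (\<integral>\<^sup>+ x. g x * indicator (path_image \<gamma>) x \<partial>mu)"

definition Gamma_mu :: "'a::metric_space measure \<Rightarrow> (real \<Rightarrow> 'a) set" where
  "Gamma_mu mu = {g. arc g \<and> (\<forall>u v. 0 \<le> u \<and> u < v \<and> v \<le> 1 \<longrightarrow>
      0 < emeasure mu (path_image (subpath' u v g)) \<and> emeasure mu (path_image (subpath' u v g)) < \<infinity>)}"

definition ug_ineq :: "'a::metric_space measure \<Rightarrow> ('a \<Rightarrow> ereal) \<Rightarrow> ('a \<Rightarrow> ennreal) \<Rightarrow> (real \<Rightarrow> 'a) \<Rightarrow> bool" where
  "ug_ineq mu f \<rho> \<gamma> \<longleftrightarrow>
     (\<bar>f (pathstart \<gamma>)\<bar> \<noteq> \<infinity> \<and> \<bar>f (pathfinish \<gamma>)\<bar> \<noteq> \<infinity> \<longrightarrow>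
       ennreal \<bar>real_of_ereal (f (pathstart \<gamma>)) - real_of_ereal (f (pathfinish \<gamma>))\<bar> \<le> line_int mu \<rho> \<gamma>)"

definition upper_gradient_in ::
  "(real \<Rightarrow> 'a) set \<Rightarrow> 'a::metric_space measure \<Rightarrow> ('a \<Rightarrow> ereal) \<Rightarrow> ('a \<Rightarrow> ennreal) \<Rightarrow> 'a set \<Rightarrow> bool" where
  "upper_gradient_in \<Gamma> mu f \<rho> A \<longleftrightarrow> \<rho> \<in> borel_measurable borel \<and>
     (\<forall>\<gamma>\<in>\<Gamma>. path_image \<gamma> \<subseteq> A \<longrightarrow> ug_ineq mu f \<rho> \<gamma>)"

definition modulus ::
  "'a::metric_space measure \<Rightarrow> 'a measure \<Rightarrow> real \<Rightarrow> (real \<Rightarrow> 'a) set \<Rightarrow> ennreal" where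
  "modulus m mu p \<Gamma> = (INF g \<in> {g. g \<in> borel_measurable borel \<and> (\<forall>\<gamma>\<in>\<Gamma>. 1 \<le> line_int mu g \<gamma>)}.
      \<integral>\<^sup>+ x. enn_powr (g x) p \<partial>m)"

definition p_weak_ug ::
  "'a::metric_space measure \<Rightarrow> 'a measure \<Rightarrow> real \<Rightarrow> (real \<Rightarrow> 'a) set \<Rightarrow> ('a \<Rightarrow> ereal) \<Rightarrow> ('a \<Rightarrow> ennreal) \<Rightarrow> bool" where
  "p_weak_ug m mu p \<Gamma> f \<rho> \<longleftrightarrow> \<rho> \<in> borel_measurable borel \<and>
     (\<exists>\<Gamma>0 \<subseteq> \<Gamma>. modulus m mu p \<Gamma>0 = 0 \<and> (\<forall>\<gamma>\<in>\<Gamma> - \<Gamma>0. ug_ineq mu f \<rho> \<gamma>))"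

definition lp_norm_e :: "'a measure \<Rightarrow> real \<Rightarrow> ('a \<Rightarrow> ereal) \<Rightarrow> ennreal" where
  "lp_norm_e m p f = enn_powr (\<integral>\<^sup>+ x. epow (f x) p \<partial>m) (1 / p)"

definition lp_norm_n :: "'a measure \<Rightarrow> real \<Rightarrow> ('a \<Rightarrow> ennreal) \<Rightarrow> ennreal" where
  "lp_norm_n m p \<rho> = enn_powr (\<integral>\<^sup>+ x. enn_powr (\<rho> x) p \<partial>m) (1 / p)"

definition Ntilde ::
  "'a::metric_space measure \<Rightarrow> 'a measure \<Rightarrow> real \<Rightarrow> (real \<Rightarrow> 'a) set \<Rightarrow> ('a \<Rightarrow> ereal) \<Rightarrow> bool" where
  "Ntilde m mu p \<Gamma> f \<longleftrightarrow> f \<in> borel_measurable m \<and> (\<integral>\<^sup>+ x. epow (f x) p \<partial>m) < \<infinity> \<and>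
     (\<exists>\<rho>. p_weak_ug m mu p \<Gamma> f \<rho> \<and> (\<integral>\<^sup>+ x. enn_powr (\<rho> x) p \<partial>m) < \<infinity>)"

definition N_norm ::
  "'a::metric_space measure \<Rightarrow> 'a measure \<Rightarrow> real \<Rightarrow> (real \<Rightarrow> 'a) set \<Rightarrow> ('a \<Rightarrow> ereal) \<Rightarrow> ennreal" where
  "N_norm m mu p \<Gamma> f = lp_norm_e m p f + (INF \<rho> \<in> {\<rho>. p_weak_ug m mu p \<Gamma> f \<rho>}. lp_norm_n m p \<rho>)"

definition doubling :: "'a::metric_space measure \<Rightarrow> bool" where
  "doubling m \<longleftrightarrow> (\<exists>C. \<forall>x r. r > 0 \<longrightarrow>
     0 < emeasure m (ball x (2 * r)) \<and> emeasure m (ball x (2 * r)) \<le> ennreal C * emeasure m (ball x r)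
     \<and> emeasure m (ball x r) < \<infinity>)"

definition poincare ::
  "'a::metric_space measure \<Rightarrow> 'a measure \<Rightarrow> real \<Rightarrow> real \<Rightarrow> (real \<Rightarrow> 'a) set \<Rightarrow> bool" where
  "poincare m mu p \<beta> \<Gamma> \<longleftrightarrow> (\<exists>C>0. \<exists>lam\<ge>1. \<forall>x r f \<rho>.
     r > 0 \<longrightarrow> f \<in> borel_measurable (restrict_space m (ball x r)) \<longrightarrow>
     (\<integral>\<^sup>+ y\<in>ball x r. e2ennreal \<bar>f y\<bar> \<partial>m) < \<infinity> \<longrightarrow>
     upper_gradient_in \<Gamma> mu f \<rho> (ball x r) \<longrightarrow>
     (let fB = (LINT y:ball x r|m. real_of_ereal (f y)) / measure m (ball x r) in
       (\<integral>\<^sup>+ y\<in>ball x r. epow (f y - ereal fB) 1 \<partial>m) / emeasure m (ball x r)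
       \<le> ennreal (C * diameter (ball x r) powr \<beta>) *
         enn_powr ((\<integral>\<^sup>+ y\<in>ball x (lam * r). enn_powr (\<rho> y) p \<partial>m) / emeasure m (ball x (lam * r))) (1 / p)))"

definition arc_chord :: "'a::metric_space measure \<Rightarrow> real \<Rightarrow> (real \<Rightarrow> 'a) set \<Rightarrow> bool" where
  "arc_chord mu \<beta> \<Gamma> \<longleftrightarrow> (\<exists>C>0. \<forall>\<gamma>\<in>\<Gamma>.
     ennreal (diameter (path_image \<gamma>) powr \<beta>) \<le> ennreal C * emeasure mu (path_image \<gamma>))"

end

theory Submission
  imports Defs
begin

text \<open>
  Lipschitz truncation. Add to a \<open>p\<close>-weak upper gradient an \<open>L\<^sup>p\<close> function with infinite
  integral on the exceptional paths, so that \<open>f\<close> gets a genuine upper gradient \<open>\<rho>\<close>, and put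
  \<open>w = |f|\<^sup>p + \<rho>\<^sup>p\<close>. Outside the union of the balls on which the mean of \<open>w\<close> exceeds \<open>l\<^sup>p\<close>,
  the Poincare inequality makes the ball averages of \<open>f\<close> converge to a bounded
  \<open>\<beta>\<close>-Hoelder function with constants of order \<open>l\<close>, whose McShane extension \<open>u\<close> agrees with \<open>f\<close>
  on a set \<open>F\<close>. The arc-chord property makes a multiple of \<open>l\<close> an upper gradient of \<open>u\<close>, so
  \<open>f - u\<close>, vanishing on \<open>F\<close>, has the weak upper gradient \<open>\<rho> + const l\<close> cut off to the
  complement of \<open>F\<close>. By the weak-type estimate, \<open>l\<^sup>p m(-F)\<close> is at most a multiple of
  \<open>\<integral>\<^bsub>{w > l\<^sup>p / 2}\<^esub> w\<close>, so all norms tend to \<open>0\<close> as \<open>l\<close> grows.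
\<close>

section \<open>Extended powers and path families of modulus zero\<close>

text \<open>Paths see \<open>m\<close>-null sets, and this shapes the argument. The Poincare
  inequality speaks of genuine upper gradients, and \<open>f = u\<close> must hold at every point of
  the set \<open>F\<close> on which the gradient is cut off. Such an \<open>F\<close> is only a
  Borel set, so a path may have no first or last parameter in \<open>F\<close>; limits of visiting
  parameters take their place, and non-atomicity of \<open>mu\<close> discards the two limit points.
  A second obstacle is the value infinity: the upper gradient inequality is void at endpoints where
  \<open>f\<close> is infinite, whereas \<open>u\<close> is finite everywhere. So
  \<open>\<rho>\<close> is also made infinite on the \<open>m\<close>-null set of infinite values. A
  path along which \<open>\<rho>\<close> has finite integral meets that set in a
  \<open>mu\<close>-null set only, and continuity of \<open>u\<close> carries estimates from nearby
  parameters to the endpoints. Finally, the constant upper gradient of \<open>u\<close> need not be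
  \<open>p\<close>-integrable on a space of infinite measure. Writing \<open>u\<close> as
  \<open>f - (f - u)\<close> gives it the weak upper gradient \<open>\<rho> + \<sigma>\<close>
  instead, where \<open>\<sigma>\<close> is the one cut off to \<open>- F\<close>.\<close>

lemma enn_powr_ennreal: "0 \<le> x \<Longrightarrow> enn_powr (ennreal x) q = ennreal (x powr q)"
  by (simp add: enn_powr_def)

lemma enn_powr_top [simp]: "enn_powr \<infinity> q = \<infinity>" "enn_powr top q = \<infinity>"
  by (auto simp: enn_powr_def)

lemma enn_powr_zero [simp]: "enn_powr 0 q = 0"
  by (simp add: enn_powr_def)

lemma enn_powr_mono: "a \<le> b \<Longrightarrow> 0 \<le> q \<Longrightarrow> enn_powr a q \<le> enn_powr b q"
  by (cases b; cases a) (auto simp: enn_powr_ennreal top_unique intro!: ennreal_leI powr_mono2)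

lemma measurable_enn_powr [measurable]: "(\<lambda>x. enn_powr x q) \<in> borel_measurable borel"
  unfolding enn_powr_def by measurable

lemma measurable_epow [measurable]: "(\<lambda>x. epow x q) \<in> borel_measurable borel"
  unfolding epow_def by measurable

lemma enn_powr_inverse: "0 < p \<Longrightarrow> enn_powr (enn_powr x p) (1 / p) = x"
  "0 < p \<Longrightarrow> enn_powr (enn_powr x (1 / p)) p = x"
  by (cases x; simp add: enn_powr_ennreal powr_powr)+

lemma enn_powr_mult:
  assumes "0 < c"
  shows "enn_powr (ennreal c * x) p = ennreal (c powr p) * enn_powr x p"
proof (cases x)
  case (real r)
  then show ?thesis using assms
    by (simp add: enn_powr_ennreal powr_mult flip: ennreal_mult)
next
  case top
  then show ?thesis using assms by (simp add: ennreal_mult_top)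
qed

lemma enn_powr_add_le:
  assumes "0 \<le> p"
  shows "enn_powr (a + b) p \<le> ennreal (2 powr p) * (enn_powr a p + enn_powr b p)"
proof -
  have "a + b \<le> ennreal 2 * max a b"
    by (simp add: mult_2 add_mono)
  then have "enn_powr (a + b) p \<le> enn_powr (ennreal 2 * max a b) p"
    using assms by (rule enn_powr_mono)
  also have "\<dots> = ennreal (2 powr p) * enn_powr (max a b) p"
    by (subst enn_powr_mult) auto
  also have "\<dots> \<le> ennreal (2 powr p) * (enn_powr a p + enn_powr b p)"
    by (intro mult_left_mono) (auto simp: max_def)
  finally show ?thesis .
qed

text \<open>Geometric weights stand in for Minkowski's inequality: every \<open>g n\<close> is at
  most \<open>(1/2) ^ n\<close> times the \<open>p\<close>-th root of the weighted energy series,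
  and these bounds sum to twice that root.\<close>

lemma enn_powr_suminf_le:
  assumes "0 < p"
  shows "enn_powr (\<Sum>n. g n) p
    \<le> ennreal (2 powr p) * (\<Sum>n. ennreal ((2 ^ n) powr p) * enn_powr (g n) p)"
proof -
  define T where "T = (\<Sum>n. ennreal ((2 ^ n) powr p) * enn_powr (g n) p)"
  have g: "g n \<le> ennreal ((1/2) ^ n) * enn_powr T (1 / p)" for n
  proof -
    have "enn_powr (ennreal (2 ^ n) * g n) p \<le> T"
      using sum_le_suminf[of "\<lambda>n. ennreal ((2 ^ n) powr p) * enn_powr (g n) p" "{n}"]
      by (subst enn_powr_mult) (auto simp: T_def)
    then have "enn_powr (enn_powr (ennreal (2 ^ n) * g n) p) (1 / p) \<le> enn_powr T (1 / p)"
      using assms by (intro enn_powr_mono) auto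
    then have "ennreal (2 ^ n) * g n \<le> enn_powr T (1 / p)"
      using assms by (simp add: enn_powr_inverse)
    then have "ennreal ((1/2) ^ n) * (ennreal (2 ^ n) * g n) \<le> ennreal ((1/2) ^ n) * enn_powr T (1 / p)"
      by (rule mult_left_mono) simp
    moreover have "ennreal ((1/2) ^ n) * (ennreal (2 ^ n) * g n) = g n"
      by (simp add: mult.assoc[symmetric] flip: ennreal_mult power_mult_distrib)
    ultimately show ?thesis by simp
  qed
  have "(\<Sum>n. g n) \<le> (\<Sum>n. ennreal ((1/2) ^ n) * enn_powr T (1 / p))"
    by (intro suminf_le g) auto
  also have "\<dots> = (\<Sum>n. ennreal ((1/2) ^ n)) * enn_powr T (1 / p)"
    by (rule ennreal_suminf_multc)
  also have "(\<Sum>n. ennreal ((1/2) ^ n)) = ennreal 2"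
    using geometric_sums[of "1/2::real"] by (intro suminf_ennreal_eq) auto
  finally have "enn_powr (\<Sum>n. g n) p \<le> enn_powr (ennreal 2 * enn_powr T (1 / p)) p"
    using assms by (intro enn_powr_mono) auto
  also have "\<dots> = ennreal (2 powr p) * T"
    using assms by (subst enn_powr_mult) (auto simp: enn_powr_inverse)
  finally show ?thesis by (simp add: T_def)
qed

lemma line_int_mono: "(\<And>x. g x \<le> h x) \<Longrightarrow> line_int mu g \<gamma> \<le> line_int mu h \<gamma>"
  unfolding line_int_def by (intro nn_integral_mono mult_right_mono) auto

lemma path_image_measurable:
  fixes mu :: "'a::metric_space measure"
  assumes "path \<gamma>" "sets mu = sets borel"
  shows "path_image \<gamma> \<in> sets mu"
  using assms compact_path_image[of \<gamma>] by (simp add: borel_compact)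

text \<open>One half of Fuglede's characterisation of modulus zero: functions admissible for
  \<open>\<Gamma>0\<close> with rapidly decreasing energies are added up, and each contributes at
  least 1 along every path of the family.\<close>

lemma modulus_zero_imp_infinite:
  fixes mu m :: "'a::metric_space measure"
  assumes p: "0 < p" and mu: "sets mu = sets borel" and m: "sets m = sets borel"
    and "modulus m mu p \<Gamma>0 = 0" and path: "\<And>\<gamma>. \<gamma> \<in> \<Gamma>0 \<Longrightarrow> path \<gamma>"
  obtains G where "G \<in> borel_measurable borel" "(\<integral>\<^sup>+ x. enn_powr (G x) p \<partial>m) < \<infinity>"
    "\<And>\<gamma>. \<gamma> \<in> \<Gamma>0 \<Longrightarrow> line_int mu G \<gamma> = \<infinity>"
proof -
  note [measurable_cong] = mu m
  \<comment> \<open>The factor \<open>((1/2) ^ n) powr p\<close> cancels the weight in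
    \<open>enn_powr_suminf_le\<close>; the factor \<open>(1/2)^n\<close> makes the remaining series
    converge.\<close>
  have "\<exists>g. g \<in> borel_measurable borel \<and> (\<forall>\<gamma>\<in>\<Gamma>0. 1 \<le> line_int mu g \<gamma>) \<and>
      (\<integral>\<^sup>+ x. enn_powr (g x) p \<partial>m) < ennreal (((1/2) ^ n) powr p * (1/2)^n)" for n :: nat
  proof -
    have "modulus m mu p \<Gamma>0 < ennreal (((1/2) ^ n) powr p * (1/2)^n)"
      using assms by simp
    then show ?thesis
      unfolding modulus_def INF_less_iff by auto
  qed
  then obtain g where g [measurable]: "\<And>n. g n \<in> borel_measurable borel"
    and g1: "\<And>n \<gamma>. \<gamma>\<in>\<Gamma>0 \<Longrightarrow> 1 \<le> line_int mu (g n) \<gamma>"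
    and gp: "\<And>n::nat. (\<integral>\<^sup>+ x. enn_powr (g n x) p \<partial>m) < ennreal (((1/2) ^ n) powr p * (1/2)^n)"
    by metis
  let ?G = "\<lambda>x. \<Sum>n. g n x"
  show ?thesis
  proof
    show "?G \<in> borel_measurable borel" by measurable
    have "(\<integral>\<^sup>+ x. enn_powr (?G x) p \<partial>m)
        \<le> (\<integral>\<^sup>+ x. ennreal (2 powr p) * (\<Sum>n. ennreal ((2 ^ n) powr p) * enn_powr (g n x) p) \<partial>m)"
      by (intro nn_integral_mono enn_powr_suminf_le p)
    also have "\<dots> = ennreal (2 powr p) * (\<Sum>n. ennreal ((2 ^ n) powr p) * (\<integral>\<^sup>+ x. enn_powr (g n x) p \<partial>m))"
      by (simp add: nn_integral_cmult nn_integral_suminf)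
    also have "\<dots> \<le> ennreal (2 powr p) * (\<Sum>n. ennreal ((1/2)^n))"
    proof (intro mult_left_mono suminf_le)
      fix n :: nat
      have "ennreal ((2 ^ n) powr p) * (\<integral>\<^sup>+ x. enn_powr (g n x) p \<partial>m)
          \<le> ennreal ((2 ^ n) powr p) * ennreal (((1/2) ^ n) powr p * (1/2)^n)"
        by (intro mult_left_mono less_imp_le[OF gp]) auto
      also have "\<dots> = ennreal ((1/2)^n)"
        by (simp add: powr_mult[symmetric] mult.assoc[symmetric] flip: ennreal_mult power_mult_distrib)
      finally show "ennreal ((2 ^ n) powr p) * (\<integral>\<^sup>+ x. enn_powr (g n x) p \<partial>m) \<le> ennreal ((1/2)^n)" .
    qed auto
    also have "(\<Sum>n. ennreal ((1/2) ^ n)) = ennreal 2"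
      using geometric_sums[of "1/2::real"] by (intro suminf_ennreal_eq) auto
    also have "ennreal (2 powr p) * ennreal 2 < \<infinity>"
      by (simp add: ennreal_mult_less_top)
    finally show "(\<integral>\<^sup>+ x. enn_powr (?G x) p \<partial>m) < \<infinity>" .
    fix \<gamma> assume \<gamma>: "\<gamma> \<in> \<Gamma>0"
    note [measurable] = path_image_measurable[OF path[OF \<gamma>] mu]
    have "line_int mu ?G \<gamma> = (\<Sum>n. line_int mu (g n) \<gamma>)"
      unfolding line_int_def by (subst nn_integral_suminf[symmetric]) auto
    also have "\<dots> \<ge> (\<Sum>n::nat. 1)"
      by (intro suminf_le g1 \<gamma>) auto
    also have "(\<Sum>n::nat. 1::ennreal) = \<infinity>"
      by (simp add: suminf_eq_SUP ennreal_SUP_of_nat_eq_top)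
    finally show "line_int mu ?G \<gamma> = \<infinity>"
      by (simp add: top_unique)
  qed
qed

text \<open>The converse half: every positive multiple of \<open>\<rho>\<close> is admissible for
  these paths, and its energy tends to 0 with the factor.\<close>

lemma modulus_infinite_eq_0:
  fixes mu m :: "'a::metric_space measure"
  assumes p: "0 < p" and mu: "sets mu = sets borel" and m: "sets m = sets borel"
    and path: "\<And>\<gamma>. \<gamma> \<in> \<Gamma> \<Longrightarrow> path \<gamma>"
    and \<rho> [measurable]: "\<rho> \<in> borel_measurable borel" and fin: "(\<integral>\<^sup>+ x. enn_powr (\<rho> x) p \<partial>m) < \<infinity>"
  shows "modulus m mu p {\<gamma>\<in>\<Gamma>. line_int mu \<rho> \<gamma> = \<infinity>} = 0"
proof -
  note [measurable_cong] = mu m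
  define I where "I = (\<integral>\<^sup>+ x. enn_powr (\<rho> x) p \<partial>m)"
  have le: "modulus m mu p {\<gamma>\<in>\<Gamma>. line_int mu \<rho> \<gamma> = \<infinity>} \<le> ennreal (c powr p) * I" if "c > 0" for c
    unfolding modulus_def
  proof (rule INF_lower2)
    show "(\<lambda>x. ennreal c * \<rho> x) \<in> {g. g \<in> borel_measurable borel \<and>
        (\<forall>\<gamma>\<in>{\<gamma>\<in>\<Gamma>. line_int mu \<rho> \<gamma> = \<infinity>}. 1 \<le> line_int mu g \<gamma>)}"
    proof safe
      fix \<gamma> assume \<gamma>: "\<gamma> \<in> \<Gamma>" "line_int mu \<rho> \<gamma> = \<infinity>"
      note [measurable] = path_image_measurable[OF path[OF \<gamma>(1)] mu]
      have "line_int mu (\<lambda>x. ennreal c * \<rho> x) \<gamma> = ennreal c * line_int mu \<rho> \<gamma>"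
        unfolding line_int_def by (subst nn_integral_cmult[symmetric]) (auto simp: mult.assoc)
      then show "1 \<le> line_int mu (\<lambda>x. ennreal c * \<rho> x) \<gamma>"
        using \<gamma> that by (simp add: ennreal_mult_top)
    qed measurable
    show "(\<integral>\<^sup>+ x. enn_powr (ennreal c * \<rho> x) p \<partial>m) \<le> ennreal (c powr p) * I"
      using that by (simp add: enn_powr_mult nn_integral_cmult I_def)
  qed
  have I: "I = ennreal (enn2real I)" using fin by (simp add: I_def)
  have "(\<lambda>n. (1 / real (Suc n)) powr p) \<longlonglongrightarrow> 0 powr p"
    using p by (intro tendsto_powr' tendsto_const lim_1_over_n[THEN LIMSEQ_Suc]) auto
  then have "(\<lambda>n. (1 / real (Suc n)) powr p) \<longlonglongrightarrow> 0" by simp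
  from tendsto_mult[OF this tendsto_const[of "enn2real I"]]
  have "(\<lambda>n. ennreal ((1 / real (Suc n)) powr p * enn2real I)) \<longlonglongrightarrow> ennreal (0 * enn2real I)"
    by (rule tendsto_ennrealI)
  then have "(\<lambda>n. ennreal ((1 / real (Suc n)) powr p) * I) \<longlonglongrightarrow> ennreal 0 * I"
    by (subst I) (simp add: ennreal_mult)
  then have "modulus m mu p {\<gamma>\<in>\<Gamma>. line_int mu \<rho> \<gamma> = \<infinity>} \<le> ennreal 0 * I"
    by (rule LIMSEQ_le_const) (intro exI[of _ 0] allI impI le, simp)
  then show ?thesis by simp
qed

text \<open>\<open>N\<close> will be the set where \<open>f\<close> is infinite. The value infinity
  on a null set costs no energy, but it forces paths with finite integral of \<open>\<rho>'\<close>
  to meet \<open>N\<close> in a \<open>mu\<close>-null set only.\<close>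

lemma p_weak_ug_imp_upper_gradient:
  fixes mu m :: "'a::metric_space measure"
  assumes p: "0 < p" and mu: "sets mu = sets borel" and m: "sets m = sets borel"
    and path: "\<And>\<gamma>. \<gamma> \<in> \<Gamma> \<Longrightarrow> path \<gamma>"
    and ug: "p_weak_ug m mu p \<Gamma> f \<rho>" and fin: "(\<integral>\<^sup>+ x. enn_powr (\<rho> x) p \<partial>m) < \<infinity>"
    and N: "N \<in> null_sets m"
  obtains \<rho>' where "\<rho>' \<in> borel_measurable borel" "(\<integral>\<^sup>+ x. enn_powr (\<rho>' x) p \<partial>m) < \<infinity>"
    "\<And>\<gamma>. \<gamma> \<in> \<Gamma> \<Longrightarrow> ug_ineq mu f \<rho>' \<gamma>" "\<And>x. x \<in> N \<Longrightarrow> \<rho>' x = \<infinity>"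
proof -
  note [measurable_cong] = mu m
  have \<rho> [measurable]: "\<rho> \<in> borel_measurable borel"
    using ug by (simp add: p_weak_ug_def)
  have [measurable]: "N \<in> sets borel" using N m by auto
  obtain \<Gamma>0 where \<Gamma>0: "\<Gamma>0 \<subseteq> \<Gamma>" "modulus m mu p \<Gamma>0 = 0" and ineq: "\<And>\<gamma>. \<gamma>\<in>\<Gamma> - \<Gamma>0 \<Longrightarrow> ug_ineq mu f \<rho> \<gamma>"
    using ug by (auto simp: p_weak_ug_def)
  obtain G where G [measurable]: "G \<in> borel_measurable borel" and Gfin: "(\<integral>\<^sup>+ x. enn_powr (G x) p \<partial>m) < \<infinity>"
    and Ginf: "\<And>\<gamma>. \<gamma> \<in> \<Gamma>0 \<Longrightarrow> line_int mu G \<gamma> = \<infinity>"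
    using modulus_zero_imp_infinite[OF p mu m \<Gamma>0(2)] path \<Gamma>0(1) by blast
  define \<rho>' where "\<rho>' x = \<rho> x + G x + \<infinity> * indicator N x" for x
  show ?thesis
  proof
    show "\<rho>' \<in> borel_measurable borel" unfolding \<rho>'_def by measurable
    have ae: "AE x in m. \<rho>' x = \<rho> x + G x"
      using AE_not_in[OF N] by eventually_elim (auto simp: \<rho>'_def)
    have "(\<integral>\<^sup>+ x. enn_powr (\<rho>' x) p \<partial>m) = (\<integral>\<^sup>+ x. enn_powr (\<rho> x + G x) p \<partial>m)"
      using ae by (intro nn_integral_cong_AE) auto
    also have "\<dots> \<le> (\<integral>\<^sup>+ x. ennreal (2 powr p) * (enn_powr (\<rho> x) p + enn_powr (G x) p) \<partial>m)"
      using p by (intro nn_integral_mono enn_powr_add_le) auto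
    also have "\<dots> = ennreal (2 powr p) * ((\<integral>\<^sup>+ x. enn_powr (\<rho> x) p \<partial>m) + (\<integral>\<^sup>+ x. enn_powr (G x) p \<partial>m))"
      by (simp add: nn_integral_cmult nn_integral_add)
    also have "\<dots> < \<infinity>"
      using fin Gfin by (simp add: ennreal_mult_less_top)
    finally show "(\<integral>\<^sup>+ x. enn_powr (\<rho>' x) p \<partial>m) < \<infinity>" .
    show "\<rho>' x = \<infinity>" if "x \<in> N" for x using that by (simp add: \<rho>'_def)
    fix \<gamma> assume \<gamma>: "\<gamma> \<in> \<Gamma>"
    show "ug_ineq mu f \<rho>' \<gamma>"
    proof (cases "\<gamma> \<in> \<Gamma>0")
      case True
      have "line_int mu G \<gamma> \<le> line_int mu \<rho>' \<gamma>"
        by (rule line_int_mono) (simp add: \<rho>'_def add_increasing2 add_increasing)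
      then show ?thesis using Ginf[OF True] by (simp add: ug_ineq_def top_unique)
    next
      case False
      have "line_int mu \<rho> \<gamma> \<le> line_int mu \<rho>' \<gamma>"
        by (rule line_int_mono) (simp add: \<rho>'_def add_increasing2 add.assoc)
      then show ?thesis using ineq[of \<gamma>] False \<gamma> by (auto simp: ug_ineq_def)
    qed
  qed
qed

section \<open>Functions vanishing on a set, along arcs\<close>

lemma path_image_subpath':
  assumes "u \<le> v"
  shows "path_image (subpath' u v \<gamma>) = \<gamma> ` {u..v}"
proof -
  have "(\<lambda>t. (v - u) * t + u) ` {0..1} = {u..v}"
  proof (cases "u = v")
    case False
    then have "(\<lambda>t. (v - u) * t + u) ` {0..1} = {(v - u) * 0 + u..(v - u) * 1 + u}"
      using assms by (subst image_affinity_atLeastAtMost) auto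
    then show ?thesis by simp
  next
    case True
    then show ?thesis by (auto intro: image_eqI[of _ _ 0])
  qed
  moreover have "path_image (subpath' u v \<gamma>) = \<gamma> ` (\<lambda>t. (v - u) * t + u) ` {0..1}"
    by (simp add: path_image_def subpath'_def image_image)
  ultimately show ?thesis by simp
qed

lemma arc_image_sets:
  fixes mu :: "'a::metric_space measure"
  assumes "arc \<gamma>" "sets mu = sets borel" "0 \<le> u" "v \<le> 1"
  shows "\<gamma> ` {u..v} \<in> sets mu"
proof -
  have "continuous_on {u..v} \<gamma>"
    using assms by (auto simp: arc_def path_def intro: continuous_on_subset)
  then show ?thesis using assms(2)
    by (simp add: borel_compact compact_continuous_image)
qed

text \<open>The limit passage behind the next lemma: \<open>a n\<close> and \<open>b n\<close> will
  be parameters of visits to a Borel set, whose extreme values \<open>s\<close> and \<open>t\<close>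
  need not be visits themselves. Outside \<open>s\<close> and \<open>t\<close> the arc runs in
  \<open>E\<close>.\<close>

lemma arc_decomposition_dominated:
  fixes mu :: "'a::metric_space measure"
  assumes mu: "sets mu = sets borel" and atom: "\<And>x. emeasure mu {x} = 0"
    and arc: "arc \<gamma>" and G [measurable]: "G \<in> borel_measurable borel"
    and fin: "line_int mu G \<gamma> < \<infinity>"
    and ab: "\<And>n. 0 \<le> a n" "\<And>n. a n \<le> 1" "\<And>n. 0 \<le> b n" "\<And>n. b n \<le> 1"
    and s: "a \<longlonglongrightarrow> s" "\<And>n. s \<le> a n" and t: "b \<longlonglongrightarrow> t" "\<And>n. b n \<le> t"
    and E [measurable]: "E \<in> sets borel" and sub: "\<And>r. 0 \<le> r \<Longrightarrow> r \<le> 1 \<Longrightarrow> r < s \<or> t < r \<Longrightarrow> \<gamma> r \<in> E"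
    and st: "s \<le> t"
    and c: "\<And>n. c \<le> line_int mu G (subpath' 0 (a n) \<gamma>) + line_int mu G (subpath' (b n) 1 \<gamma>)"
  shows "c \<le> line_int mu (\<lambda>x. G x * indicator E x) \<gamma>"
proof -
  note [measurable_cong] = mu
  \<comment> \<open>Injectivity turns membership in the image of a subinterval into inequalities
    between parameters.\<close>
  have inj: "\<gamma> r \<in> \<gamma> ` {u..v} \<longleftrightarrow> u \<le> r \<and> r \<le> v" if "0 \<le> r" "r \<le> 1" "0 \<le> u" "v \<le> 1" for r u v
    using arc that inj_on_image_mem_iff[of \<gamma> "{0..1}" r "{u..v}"] by (auto simp: arc_def)
  have st01: "0 \<le> s" "s \<le> 1" "0 \<le> t" "t \<le> 1"
    using LIMSEQ_le_const[OF s(1)] LIMSEQ_le_const2[OF s(1)] LIMSEQ_le_const[OF t(1)] LIMSEQ_le_const2[OF t(1)] ab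
    by blast+
  define P where "P = path_image \<gamma>"
  define I where "I a b x = (indicator (\<gamma> ` {0..a}) x + indicator (\<gamma> ` {b..1}) x :: ennreal)" for a b :: real and x
  have [measurable]: "P \<in> sets borel"
    using path_image_measurable[OF arc_imp_path[OF arc] mu] mu by (simp add: P_def)
  have imgs: "\<gamma> ` {u..v} \<in> sets borel" if "0 \<le> u" "v \<le> 1" for u v
    using arc_image_sets[OF arc mu that] mu by simp
  have Im: "I a b \<in> borel_measurable borel" if "0 \<le> a" "a \<le> 1" "0 \<le> b" "b \<le> 1" for a b
    unfolding I_def using that imgs by (intro borel_measurable_add borel_measurable_indicator) auto
  have [measurable]: "I (a n) (b n) \<in> borel_measurable borel" for n
    using ab by (intro Im)
  have [measurable]: "I s t \<in> borel_measurable borel"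
    using st01 by (intro Im)
  have eq: "line_int mu G (subpath' 0 a \<gamma>) + line_int mu G (subpath' b 1 \<gamma>) = (\<integral>\<^sup>+x. G x * I a b x \<partial>mu)"
    if "0 \<le> a" "a \<le> 1" "0 \<le> b" "b \<le> 1" for a b
  proof -
    have [measurable]: "\<gamma> ` {0..a} \<in> sets borel" "\<gamma> ` {b..1} \<in> sets borel"
      using that by (auto intro!: imgs)
    show ?thesis
      using that by (simp add: line_int_def path_image_subpath' I_def distrib_left nn_integral_add)
  qed
  have "(\<lambda>n. \<integral>\<^sup>+x. G x * I (a n) (b n) x \<partial>mu) \<longlonglongrightarrow> (\<integral>\<^sup>+x. G x * I s t x \<partial>mu)"
  proof (rule nn_integral_dominated_convergence)
    \<comment> \<open>The factor 2 allows for \<open>b n \<le> a n\<close>, when the two pieces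
      overlap.\<close>
    have I2: "I a b x \<le> 2 * indicator P x" if "0 \<le> a" "a \<le> 1" "0 \<le> b" "b \<le> 1" for a b x
      using that by (auto simp: I_def P_def path_image_def indicator_def)
    show "AE x in mu. G x * I (a j) (b j) x \<le> G x * (2 * indicator P x)" for j
      using ab by (intro AE_I2 mult_left_mono I2) auto
    have "(\<integral>\<^sup>+x. G x * (2 * indicator P x) \<partial>mu) = 2 * line_int mu G \<gamma>"
      unfolding line_int_def P_def[symmetric]
      by (subst nn_integral_cmult[symmetric]) (auto simp: mult_ac)
    then show "(\<integral>\<^sup>+x. G x * (2 * indicator P x) \<partial>mu) < \<infinity>"
      using fin by (simp add: ennreal_mult_less_top)
    \<comment> \<open>Approximation from one side, \<open>s \<le> a n\<close> and
      \<open>b n \<le> t\<close>, makes the indicators eventually constant even at the parameters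
      \<open>s\<close> and \<open>t\<close>.\<close>
    have ev: "eventually (\<lambda>n. I (a n) (b n) x = I s t x) sequentially" for x
    proof (cases "x \<in> P")
      case False
      then have "x \<notin> \<gamma> ` {0..a}" "x \<notin> \<gamma> ` {b..1}" if "0 \<le> a" "a \<le> 1" "0 \<le> b" "b \<le> 1" for a b
        using that by (auto simp: P_def path_image_def)
      then show ?thesis using st01 ab by (auto simp: I_def indicator_def)
    next
      case True
      then obtain r where r: "0 \<le> r" "r \<le> 1" "x = \<gamma> r"
        by (auto simp: P_def path_image_def)
      have mem: "x \<in> \<gamma> ` {0..a} \<longleftrightarrow> r \<le> a" "x \<in> \<gamma> ` {b..1} \<longleftrightarrow> b \<le> r"
        if "0 \<le> a" "a \<le> 1" "0 \<le> b" "b \<le> 1" for a b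
        using that r by (simp_all add: inj)
      have "eventually (\<lambda>n. r \<le> a n \<longleftrightarrow> r \<le> s) sequentially"
      proof (cases "r \<le> s")
        case True
        then show ?thesis using s(2) order_trans by (intro always_eventually) blast
      next
        case False
        then show ?thesis using order_tendstoD(2)[OF s(1), of r] by (auto elim: eventually_mono)
      qed
      moreover have "eventually (\<lambda>n. b n \<le> r \<longleftrightarrow> t \<le> r) sequentially"
      proof (cases "t \<le> r")
        case True
        then show ?thesis using t(2) order_trans by (intro always_eventually) blast
      next
        case False
        then show ?thesis using order_tendstoD(1)[OF t(1), of r] by (auto elim: eventually_mono)
      qed
      ultimately show ?thesis
        by eventually_elim (use st01 ab mem in \<open>simp add: I_def indicator_def\<close>)
    qed
    have "eventually (\<lambda>n. G x * I (a n) (b n) x = G x * I s t x) sequentially" for x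
      using ev[of x] by (rule eventually_mono) simp
    then show "AE x in mu. (\<lambda>n. G x * I (a n) (b n) x) \<longlonglongrightarrow> G x * I s t x"
      by (intro AE_I2 tendsto_eventually)
  qed measurable
  then have "c \<le> (\<integral>\<^sup>+x. G x * I s t x \<partial>mu)"
    by (rule LIMSEQ_le_const) (intro exI[of _ 0] allI impI, use c ab in \<open>simp add: eq\<close>)
  also have "\<dots> \<le> (\<integral>\<^sup>+x. G x * indicator E x * indicator P x \<partial>mu)"
  proof (rule nn_integral_mono_AE)
    \<comment> \<open>The limit points \<open>\<gamma> s\<close> and \<open>\<gamma> t\<close> may
      lie outside \<open>E\<close>; here non-atomicity enters.\<close>
    have "AE x in mu. x \<noteq> \<gamma> s" "AE x in mu. x \<noteq> \<gamma> t"
      using atom mu AE_not_in[of "{\<gamma> s}" mu] AE_not_in[of "{\<gamma> t}" mu] by (auto simp: null_sets_def)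
    then show "AE x in mu. G x * I s t x \<le> G x * indicator E x * indicator P x"
    proof eventually_elim
      case (elim x)
      have "I s t x \<le> indicator E x * indicator P x"
      proof (cases "x \<in> P")
        case True
        then obtain r where r: "0 \<le> r" "r \<le> 1" "x = \<gamma> r"
          by (auto simp: P_def path_image_def)
        have "x \<in> \<gamma> ` {0..s} \<longleftrightarrow> r \<le> s" "x \<in> \<gamma> ` {t..1} \<longleftrightarrow> t \<le> r"
          using st01 r by (simp_all add: inj)
        moreover have "r \<noteq> s" "r \<noteq> t" using elim r by auto
        ultimately show ?thesis using sub[of r] r st True
          by (auto simp: I_def indicator_def)
      next
        case False
        then have "x \<notin> \<gamma> ` {0..s}" "x \<notin> \<gamma> ` {t..1}"
          using st01 by (auto simp: P_def path_image_def)
        then show ?thesis by (simp add: I_def)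
      qed
      then show ?case
        by (simp add: mult.assoc mult_left_mono)
    qed
  qed
  finally show ?thesis by (simp add: line_int_def P_def)
qed

text \<open>Only the initial and the final part of an arc, up to the first and from the last visit
  to \<open>F\<close>, contribute to the increment of a function vanishing on \<open>F\<close>.\<close>
lemma arc_increment_off_zero_set:
  fixes mu :: "'a::metric_space measure" and h :: "'a \<Rightarrow> ereal"
  assumes mu: "sets mu = sets borel" and atom: "\<And>x. emeasure mu {x} = 0"
    and arc: "arc \<gamma>" and G [measurable]: "G \<in> borel_measurable borel"
    and fin: "line_int mu G \<gamma> < \<infinity>"
    and F: "F \<in> sets borel" and h0: "\<And>x. x \<in> F \<Longrightarrow> h x = 0"
    and ug: "\<And>u v. 0 \<le> u \<Longrightarrow> u < v \<Longrightarrow> v \<le> 1 \<Longrightarrow> ug_ineq mu h G (subpath' u v \<gamma>)"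
  shows "ug_ineq mu h (\<lambda>x. G x * indicator (- F) x) \<gamma>"
  unfolding ug_ineq_def
proof (rule impI, elim conjE)
  assume hfin: "\<bar>h (pathstart \<gamma>)\<bar> \<noteq> \<infinity>" "\<bar>h (pathfinish \<gamma>)\<bar> \<noteq> \<infinity>"
  define r where "r t = real_of_ereal (h (\<gamma> t))" for t
  have incr: "ennreal \<bar>r u - r v\<bar> \<le> line_int mu G (subpath' u v \<gamma>)"
    if "0 \<le> u" "u \<le> v" "v \<le> 1" "\<bar>h (\<gamma> u)\<bar> \<noteq> \<infinity>" "\<bar>h (\<gamma> v)\<bar> \<noteq> \<infinity>" for u v
  proof (cases "u = v")
    case False
    then show ?thesis
      using ug[of u v] that by (simp add: ug_ineq_def r_def subpath'_def pathstart_def pathfinish_def)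
  qed simp
  have ends: "\<bar>h (\<gamma> 0)\<bar> \<noteq> \<infinity>" "\<bar>h (\<gamma> 1)\<bar> \<noteq> \<infinity>"
    using hfin by (auto simp: pathstart_def pathfinish_def)
  define Z where "Z = {t\<in>{0..1}. \<gamma> t \<in> F}"
  have "ennreal \<bar>r 0 - r 1\<bar> \<le> line_int mu (\<lambda>x. G x * indicator (- F) x) \<gamma>"
  proof (cases "Z = {}")
    case True
    have "subpath' 0 1 \<gamma> = \<gamma>" by (simp add: subpath'_def)
    then have "ennreal \<bar>r 0 - r 1\<bar> \<le> line_int mu G \<gamma>"
      using incr[of 0 1] ends by simp
    also have "\<dots> = line_int mu (\<lambda>x. G x * indicator (- F) x) \<gamma>"
      unfolding line_int_def using True
      by (intro nn_integral_cong) (auto simp: Z_def path_image_def indicator_def)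
    finally show ?thesis .
  next
    case False
    have bdd: "bdd_below Z" "bdd_above Z"
      by (auto simp: Z_def intro!: bdd_belowI[of _ 0] bdd_aboveI[of _ 1])
    \<comment> \<open>\<open>Z\<close> need not be closed, so its extreme values are only limits of
      parameters at which \<open>h\<close> vanishes.\<close>
    have "Inf Z \<in> closure Z" "Sup Z \<in> closure Z"
      using False bdd by (auto intro: closure_contains_Inf closure_contains_Sup)
    then obtain a b where a: "\<And>n. a n \<in> Z" "a \<longlonglongrightarrow> Inf Z" and b: "\<And>n. b n \<in> Z" "b \<longlonglongrightarrow> Sup Z"
      unfolding closure_sequential by metis
    have ab: "0 \<le> a n" "a n \<le> 1" "0 \<le> b n" "b n \<le> 1" for n
      using a(1)[of n] b(1)[of n] by (auto simp: Z_def)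
    have zero: "h (\<gamma> (a n)) = 0" "h (\<gamma> (b n)) = 0" for n
      using a(1)[of n] b(1)[of n] h0 by (auto simp: Z_def)
    have "ennreal \<bar>r 0 - r 1\<bar> \<le> line_int mu G (subpath' 0 (a n) \<gamma>) + line_int mu G (subpath' (b n) 1 \<gamma>)" for n
    proof -
      have "r (a n) = 0" "r (b n) = 0" using zero by (auto simp: r_def)
      then have "\<bar>r 0 - r 1\<bar> \<le> \<bar>r 0 - r (a n)\<bar> + \<bar>r (b n) - r 1\<bar>" by simp
      then have "ennreal \<bar>r 0 - r 1\<bar> \<le> ennreal \<bar>r 0 - r (a n)\<bar> + ennreal \<bar>r (b n) - r 1\<bar>"
        by (simp flip: ennreal_plus)
      also have "\<dots> \<le> line_int mu G (subpath' 0 (a n) \<gamma>) + line_int mu G (subpath' (b n) 1 \<gamma>)"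
        using ends zero ab by (intro add_mono incr) auto
      finally show ?thesis .
    qed
    moreover have "\<gamma> q \<in> - F" if "0 \<le> q" "q \<le> 1" "q < Inf Z \<or> Sup Z < q" for q
    proof
      assume "\<gamma> q \<in> F"
      then have "q \<in> Z" using that by (simp add: Z_def)
      then show False using that cInf_lower[OF _ bdd(1)] cSup_upper[OF _ bdd(2)] by force
    qed
    moreover have "Inf Z \<le> Sup Z"
      using False bdd by (intro cInf_le_cSup)
    moreover have "Inf Z \<le> a n" "b n \<le> Sup Z" for n
      using cInf_lower[OF a(1) bdd(1)] cSup_upper[OF b(1) bdd(2)] by auto
    ultimately show ?thesis
      using F ab a(2) b(2)
      by (intro arc_decomposition_dominated[OF mu atom arc G fin, where a = a and b = b and s = "Inf Z" and t = "Sup Z"])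
        auto
  qed
  then show "ennreal \<bar>real_of_ereal (h (pathstart \<gamma>)) - real_of_ereal (h (pathfinish \<gamma>))\<bar>
      \<le> line_int mu (\<lambda>x. G x * indicator (- F) x) \<gamma>"
    by (simp add: r_def pathstart_def pathfinish_def)
qed

section \<open>Covering and maximal inequalities in doubling spaces\<close>

lemma finite_vitali_covering:
  fixes I :: "('a::metric_space \<times> real) set"
  assumes "finite I"
  obtains J where "J \<subseteq> I" "disjoint_family_on (\<lambda>(a, r). ball a r) J"
    "(\<Union>(a, r)\<in>I. ball a r) \<subseteq> (\<Union>(a, r)\<in>J. ball a (3 * r))"
proof -
  have "\<exists>J. J \<subseteq> I \<and> disjoint_family_on (\<lambda>(a, r). ball a r) J \<and>
    (\<Union>(a, r)\<in>I. ball a r) \<subseteq> (\<Union>(a, r)\<in>J. ball a (3 * r))"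
    using assms
  proof (induction "card I" arbitrary: I rule: less_induct)
    case less
    show ?case
    proof (cases "I = {}")
      case True
      then show ?thesis by (auto simp: disjoint_family_on_def)
    next
      case False
      \<comment> \<open>Greedy choice: a ball of largest radius, once tripled, swallows every ball
        that meets it.\<close>
      then obtain a r where ar: "(a, r) \<in> I" and max: "\<And>b s. (b, s) \<in> I \<Longrightarrow> s \<le> r"
        using less.prems Max_in[of "snd ` I"] Max_ge[of "snd ` I"] by fastforce
      \<comment> \<open>Radii may be nonpositive, and an empty ball does not meet itself; removing
        \<open>(a, r)\<close> explicitly guarantees that the induction descends.\<close>
      define I' where "I' = {(b, s) \<in> I. ball b s \<inter> ball a r = {}} - {(a, r)}"
      have "card I' < card I"
        using ar less.prems by (intro psubset_card_mono) (auto simp: I'_def)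
      moreover have "finite I'"
        using less.prems by (auto simp: I'_def intro: finite_subset)
      ultimately obtain J where J: "J \<subseteq> I'" "disjoint_family_on (\<lambda>(a, r). ball a r) J"
        "(\<Union>(a, r)\<in>I'. ball a r) \<subseteq> (\<Union>(a, r)\<in>J. ball a (3 * r))"
        using less.hyps[of I'] by auto
      have "ball b s \<subseteq> ball a (3 * r)" if bs: "(b, s) \<in> I" "(b, s) \<notin> I'" for b s
      proof (cases "(b, s) = (a, r)")
        case False
        then obtain z where z: "dist b z < s" "dist a z < r"
          using bs by (auto simp: I'_def)
        show ?thesis
        proof
          fix y assume "y \<in> ball b s"
          then have "dist b y < s" by simp
          moreover have "dist a y \<le> dist a z + dist b z + dist b y"
            using dist_triangle[of a y z] dist_triangle[of z y b] by (simp add: dist_commute)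
          ultimately show "y \<in> ball a (3 * r)"
            using z max[OF bs(1)] by simp
        qed
      next
        case True
        show ?thesis
        proof
          fix y assume "y \<in> ball b s"
          then have "dist a y < r" using True by simp
          then show "y \<in> ball a (3 * r)"
            unfolding mem_ball using zero_le_dist[of a y] by linarith
        qed
      qed
      moreover have "ball b s \<subseteq> (\<Union>(a, r)\<in>J. ball a (3 * r))" if "(b, s) \<in> I'" for b s
        using J(3) that by auto
      ultimately have "(\<Union>(a, r)\<in>I. ball a r) \<subseteq> (\<Union>(a, r)\<in>insert (a, r) J. ball a (3 * r))"
        by fastforce
      moreover have "disjoint_family_on (\<lambda>(a, r). ball a r) (insert (a, r) J)"
        using J(1,2) by (auto simp: disjoint_family_on_def I'_def)
      ultimately show ?thesis
        using J(1) ar by (intro exI[of _ "insert (a, r) J"]) (auto simp: I'_def)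
    qed
  qed
  then show ?thesis using that by blast
qed

text \<open>A comparison on single balls passes to their union: disjoint balls whose triples cover a
  finite subfamily are extracted, and finite subfamilies exhaust. It serves twice with exchanged
  roles: \<open>\<nu>\<close> is \<open>m\<close> in the maximal inequality, \<open>\<kappa>\<close>
  is \<open>m\<close> when the limits of ball averages are identified with the function.\<close>

lemma vitali_measure_le:
  fixes \<nu> \<kappa> :: "'a::metric_space measure" and I :: "('a \<times> real) set"
  assumes sets: "sets \<nu> = sets borel" "sets \<kappa> = sets borel" and "countable I"
    and le: "\<And>a r. (a, r) \<in> I \<Longrightarrow> emeasure \<nu> (ball a (3 * r)) \<le> K * emeasure \<kappa> (ball a r)"
  shows "emeasure \<nu> (\<Union>(a, r)\<in>I. ball a r) \<le> K * emeasure \<kappa> (\<Union>(a, r)\<in>I. ball a r)"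
proof (cases "I = {}")
  case False
  have meas: "open A \<Longrightarrow> A \<in> sets \<nu>" "open A \<Longrightarrow> A \<in> sets \<kappa>" for A
    using sets by auto
  have fin: "emeasure \<nu> (\<Union>(a, r)\<in>I'. ball a r) \<le> K * emeasure \<kappa> (\<Union>(a, r)\<in>I. ball a r)"
    if I': "finite I'" "I' \<subseteq> I" for I'
  proof -
    obtain J where J: "J \<subseteq> I'" "disjoint_family_on (\<lambda>(a, r). ball a r) J"
      "(\<Union>(a, r)\<in>I'. ball a r) \<subseteq> (\<Union>(a, r)\<in>J. ball a (3 * r))"
      using finite_vitali_covering[OF I'(1)] .
    have "finite J" using J(1) I'(1) by (rule finite_subset)
    have "emeasure \<nu> (\<Union>(a, r)\<in>I'. ball a r) \<le> emeasure \<nu> (\<Union>(a, r)\<in>J. ball a (3 * r))"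
      using J(3) by (intro emeasure_mono meas open_UN) auto
    also have "\<dots> \<le> (\<Sum>(a, r)\<in>J. emeasure \<nu> (ball a (3 * r)))"
      using \<open>finite J\<close> meas
      using emeasure_subadditive_finite[of J "\<lambda>(a, r). ball a (3 * r)" \<nu>]
      by (auto simp: case_prod_unfold)
    also have "\<dots> \<le> (\<Sum>(a, r)\<in>J. K * emeasure \<kappa> (ball a r))"
      using J(1) I'(2) le by (intro sum_mono) auto
    also have "\<dots> = K * (\<Sum>x\<in>J. emeasure \<kappa> (case x of (a, r) \<Rightarrow> ball a r))"
      by (simp add: sum_distrib_left case_prod_unfold)
    also have "\<dots> = K * emeasure \<kappa> (\<Union>(a, r)\<in>J. ball a r)"
      using \<open>finite J\<close> meas J(2)
      by (subst sum_emeasure) auto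
    also have "\<dots> \<le> K * emeasure \<kappa> (\<Union>(a, r)\<in>I. ball a r)"
      using J(1) I'(2) by (intro mult_left_mono emeasure_mono meas open_UN) auto
    finally show ?thesis .
  qed
  define A where "A n = (\<Union>(a, r)\<in>from_nat_into I ` {..<n}. ball a r)" for n :: nat
  have "(\<Union>n. A n) = (\<Union>(a, r)\<in>range (from_nat_into I). ball a r)"
    unfolding A_def case_prod_unfold by (auto; use lessI in blast)
  then have UA: "(\<Union>n. A n) = (\<Union>(a, r)\<in>I. ball a r)"
    using False assms(3) by (simp add: range_from_nat_into)
  have "range A \<subseteq> sets \<nu>"
    by (auto simp: A_def case_prod_unfold intro!: meas open_UN)
  moreover have "incseq A"
    unfolding A_def by (intro monoI UN_mono image_mono) auto
  ultimately have "emeasure \<nu> (\<Union>n. A n) = (SUP n. emeasure \<nu> (A n))"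
    by (rule SUP_emeasure_incseq[symmetric])
  also have "\<dots> \<le> K * emeasure \<kappa> (\<Union>(a, r)\<in>I. ball a r)"
    unfolding A_def using False by (intro SUP_least fin) (auto intro: from_nat_into)
  finally show ?thesis by (simp add: UA)
qed simp

section \<open>Ball volumes, finite nets and separability under a doubling measure\<close>

locale doubling_space =
  fixes m :: "'a::metric_space measure" and Cd :: real
  assumes sets_m: "sets m = sets borel"
    and measure_ball_pos: "0 < r \<Longrightarrow> 0 < measure m (ball x r)"
    and emeasure_ball_finite: "emeasure m (ball x r) < \<infinity>"
    and doubling_le: "0 < r \<Longrightarrow> measure m (ball x (2 * r)) \<le> Cd * measure m (ball x r)"
begin

lemma ball_sets [measurable]: "ball x r \<in> sets m"
  by (simp add: sets_m)

lemma emeasure_ball: "emeasure m (ball x r) = ennreal (measure m (ball x r))"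
  using emeasure_ball_finite by (intro emeasure_eq_ennreal_measure) (simp add: top.not_eq_extremum)

lemma fmeasurable_ball: "ball x r \<in> fmeasurable m"
  by (intro fmeasurableI ball_sets emeasure_ball_finite)

lemma measure_ball_mono: "ball x r \<subseteq> ball y s \<Longrightarrow> measure m (ball x r) \<le> measure m (ball y s)"
  by (intro measure_mono_fmeasurable ball_sets fmeasurable_ball)

lemma Cd_ge_1: "1 \<le> Cd"
proof -
  have "measure m (ball undefined 1) \<le> measure m (ball undefined 2)"
    by (intro measure_ball_mono) auto
  also have "\<dots> \<le> Cd * measure m (ball undefined 1)"
    using doubling_le[of 1] by simp
  finally show ?thesis
    using measure_ball_pos[of 1] by simp
qed

lemma doubling_iterate:
  assumes "0 < r"
  shows "measure m (ball x (2 ^ n * r)) \<le> Cd ^ n * measure m (ball x r)"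
proof (induction n)
  case (Suc n)
  have "measure m (ball x (2 ^ Suc n * r)) \<le> Cd * measure m (ball x (2 ^ n * r))"
    using doubling_le[of "2 ^ n * r"] assms by (simp add: mult.assoc)
  also have "\<dots> \<le> Cd * (Cd ^ n * measure m (ball x r))"
    using Suc Cd_ge_1 by (intro mult_left_mono) auto
  finally show ?case by (simp add: mult_ac)
qed simp

text \<open>The hypothesis puts \<open>ball y s\<close> inside \<open>ball x (2 ^ n * r)\<close> as
  soon as \<open>A < 2 ^ n\<close>, so iterated doubling gives one constant for all centres and
  radii.\<close>

lemma measure_ball_scale_le:
  obtains K where "1 \<le> K" "\<And>x y r s. 0 < r \<Longrightarrow> s + dist x y \<le> A * r \<Longrightarrow> measure m (ball y s) \<le> K * measure m (ball x r)"
proof -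
  obtain n where n: "A < 2 ^ n" using real_arch_pow[of 2 A] by auto
  show ?thesis
  proof
    show "1 \<le> Cd ^ n" using Cd_ge_1 by simp
    fix x y :: 'a and r s assume r: "0 < (r::real)" "s + dist x y \<le> A * r"
    have "s + dist x y \<le> 2 ^ n * r"
      using mult_right_mono[OF less_imp_le[OF n] less_imp_le[OF r(1)]] r(2) by linarith
    have "ball y s \<subseteq> ball x (2 ^ n * r)"
    proof
      fix z assume "z \<in> ball y s"
      then show "z \<in> ball x (2 ^ n * r)"
        unfolding mem_ball using dist_triangle[of x z y] \<open>s + dist x y \<le> 2 ^ n * r\<close> by linarith
    qed
    then have "measure m (ball y s) \<le> measure m (ball x (2 ^ n * r))"
      by (rule measure_ball_mono)
    then show "measure m (ball y s) \<le> Cd ^ n * measure m (ball x r)"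
      using doubling_iterate[OF r(1), of x n] by simp
  qed
qed

text \<open>Volume bounds the cardinality of separated sets: the balls of radius
  \<open>\<epsilon> / 2\<close> about their points are disjoint, of comparable measure, and
  contained in one larger ball. A separated set of greatest cardinality is then a net.\<close>

lemma finite_net:
  fixes x0 :: 'a
  assumes "0 < \<epsilon>" "0 < R"
  obtains N where "finite N" "N \<subseteq> ball x0 R" "ball x0 R \<subseteq> (\<Union>a\<in>N. ball a \<epsilon>)"
proof -
  \<comment> \<open>The ratio is the one between \<open>R + \<epsilon> + R\<close>, which reaches
    around all of \<open>ball x0 (R + \<epsilon>)\<close> from a point of \<open>ball x0 R\<close>,
    and the small radius \<open>\<epsilon> / 2\<close>.\<close>
  obtain K where K: "1 \<le> K" "\<And>x y r s. 0 < r \<Longrightarrow> s + dist x y \<le> ((R + \<epsilon> + R) * 2 / \<epsilon>) * r \<Longrightarrow> measure m (ball y s) \<le> K * measure m (ball x r)"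
    using measure_ball_scale_le by blast
  define sep where "sep N \<longleftrightarrow> finite N \<and> N \<subseteq> ball x0 R \<and> (\<forall>a\<in>N. \<forall>b\<in>N. a \<noteq> b \<longrightarrow> \<epsilon> \<le> dist a b)" for N
  have card: "real (card N) \<le> K" if "sep N" for N
  proof -
    have disj: "disjoint_family_on (\<lambda>a. ball a (\<epsilon> / 2)) N"
    proof (unfold disjoint_family_on_def, intro ballI impI)
      fix a b assume "a \<in> N" "b \<in> N" "a \<noteq> b"
      then have "\<epsilon> \<le> dist a b" using that by (auto simp: sep_def)
      then show "ball a (\<epsilon> / 2) \<inter> ball b (\<epsilon> / 2) = {}"
        using dist_triangle_half_l[of a _ \<epsilon> b] by (force simp: dist_commute)
    qed
    have "real (card N) * measure m (ball x0 (R + \<epsilon>)) = (\<Sum>a\<in>N. measure m (ball x0 (R + \<epsilon>)))" by simp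
    also have "\<dots> \<le> (\<Sum>a\<in>N. K * measure m (ball a (\<epsilon> / 2)))"
    proof (intro sum_mono K)
      fix a assume "a \<in> N"
      then have "dist a x0 < R" using that by (auto simp: sep_def dist_commute)
      then show "R + \<epsilon> + dist a x0 \<le> (R + \<epsilon> + R) * 2 / \<epsilon> * (\<epsilon> / 2)"
        using assms by simp
    qed (use assms in auto)
    also have "\<dots> = K * measure m (\<Union>a\<in>N. ball a (\<epsilon> / 2))"
      using that disj emeasure_ball_finite unfolding sum_distrib_left[symmetric]
      by (subst measure_finite_Union) (auto simp: sep_def top.not_eq_extremum)
    also have "\<dots> \<le> K * measure m (ball x0 (R + \<epsilon>))"
    proof (intro mult_left_mono measure_mono_fmeasurable fmeasurable_ball)
      show "(\<Union>a\<in>N. ball a (\<epsilon> / 2)) \<subseteq> ball x0 (R + \<epsilon>)"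
      proof safe
        fix a y assume "a \<in> N" "y \<in> ball a (\<epsilon> / 2)"
        then have "dist x0 a < R" "dist a y < \<epsilon> / 2" using that by (auto simp: sep_def)
        then show "y \<in> ball x0 (R + \<epsilon>)"
          using dist_triangle[of x0 y a] assms by simp
      qed
    qed (use K(1) that in \<open>auto simp: sep_def\<close>)
    finally show ?thesis
      using measure_ball_pos[of "R + \<epsilon>" x0] assms by simp
  qed
  have "sep {}" by (simp add: sep_def)
  moreover have "card N < Suc (nat \<lceil>K\<rceil>)" if "sep N" for N
    using card[OF that] by linarith
  ultimately obtain N where N: "sep N" "\<And>N'. sep N' \<Longrightarrow> card N' \<le> card N"
    using ex_has_greatest_nat[of sep "{}" card "Suc (nat \<lceil>K\<rceil>)"] by (metis less_imp_le)
  show ?thesis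
  proof
    show "finite N" "N \<subseteq> ball x0 R" using N by (auto simp: sep_def)
    show "ball x0 R \<subseteq> (\<Union>a\<in>N. ball a \<epsilon>)"
    proof (rule ccontr)
      assume "\<not> ?thesis"
      then obtain y where y: "y \<in> ball x0 R" "\<And>a. a \<in> N \<Longrightarrow> \<epsilon> \<le> dist a y"
        by force
      then have "sep (insert y N)" using N(1) by (auto simp: sep_def dist_commute)
      then have "card (insert y N) \<le> card N" by (rule N(2))
      moreover have "y \<notin> N" using y(2)[of y] assms by auto
      ultimately show False using \<open>finite N\<close> by simp
    qed
  qed
qed

text \<open>Separability is what makes the families of balls in the covering arguments
  countable.\<close>

lemma countable_dense:
  obtains D :: "'a set" where "countable D" "\<And>x \<epsilon>. 0 < \<epsilon> \<Longrightarrow> \<exists>a\<in>D. dist a x < \<epsilon>"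
proof -
  fix x0 :: 'a
  have "\<exists>N. finite N \<and> ball x0 (real (Suc k)) \<subseteq> (\<Union>a\<in>N. ball a (1 / real (Suc n)))" for k n
    using finite_net[of "1 / real (Suc n)" "real (Suc k)" x0] by (metis of_nat_0_less_iff zero_less_Suc zero_less_divide_1_iff)
  then obtain N where N: "\<And>k n. finite (N k n)"
      "\<And>k n. ball x0 (real (Suc k)) \<subseteq> (\<Union>a\<in>N k n. ball a (1 / real (Suc n)))"
    by metis
  show ?thesis
  proof
    show "countable (\<Union>k n. N k n)"
      using N(1) by (intro countable_UN) (auto intro: countable_finite)
    fix x and \<epsilon> :: real assume "0 < \<epsilon>"
    then obtain n where n: "1 / real (Suc n) < \<epsilon>" using nat_approx_posE by blast
    obtain k where "dist x0 x < real k" using reals_Archimedean2 by blast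
    then have "x \<in> ball x0 (real (Suc k))" by simp
    then obtain a where "a \<in> N k n" "dist a x < 1 / real (Suc n)" using N(2)[of k n] by auto
    then show "\<exists>a\<in>\<Union>k n. N k n. dist a x < \<epsilon>" using n by (intro bexI[of _ a]) auto
  qed
qed

end

text \<open>Only the part of \<open>w\<close> above \<open>\<tau> / 2\<close> enters the bound for
  \<open>- F\<close>. This tail is what later makes \<open>\<tau> * emeasure m (- F)\<close> tend to
  0 as \<open>\<tau>\<close> grows, instead of merely staying bounded.\<close>

lemma (in doubling_space) weak_type_maximal:
  assumes lam: "0 < lam"
  obtains K where "1 \<le> K"
    and "\<And>w \<tau>. w \<in> borel_measurable borel \<Longrightarrow> 0 < \<tau> \<Longrightarrow> \<exists>F\<in>sets borel.
      emeasure m (- F) \<le> ennreal (K / \<tau>) * (\<integral>\<^sup>+x. w x * indicator {x. ennreal (\<tau> / 2) < w x} x \<partial>m) \<and>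
      (\<forall>x\<in>F. \<forall>i::nat. (\<integral>\<^sup>+y\<in>ball x (lam * (1/2)^i). w y \<partial>m)
         \<le> ennreal (K * \<tau> * measure m (ball x (lam * (1/2)^i))))"
proof -
  obtain K1 where K1: "1 \<le> K1" "\<And>x y r s. 0 < r \<Longrightarrow> s + dist x y \<le> 3 * r \<Longrightarrow> measure m (ball y s) \<le> K1 * measure m (ball x r)"
    using measure_ball_scale_le by blast
  obtain D :: "'a set" where D: "countable D" "\<And>x \<epsilon>. 0 < \<epsilon> \<Longrightarrow> \<exists>a\<in>D. dist a x < \<epsilon>"
    using countable_dense by blast
  have "\<exists>F\<in>sets borel.
      emeasure m (- F) \<le> ennreal (2 * K1 / \<tau>) * (\<integral>\<^sup>+x. w x * indicator {x. ennreal (\<tau> / 2) < w x} x \<partial>m) \<and>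
      (\<forall>x\<in>F. \<forall>i::nat. (\<integral>\<^sup>+y\<in>ball x (lam * (1/2)^i). w y \<partial>m)
         \<le> ennreal (2 * K1 * \<tau> * measure m (ball x (lam * (1/2)^i))))"
    if w [measurable]: "w \<in> borel_measurable borel" and \<tau>: "0 < \<tau>" for w :: "'a \<Rightarrow> ennreal" and \<tau> :: real
  proof -
    note [measurable_cong] = sets_m
    \<comment> \<open>Where the mean of \<open>w\<close> over a ball exceeds \<open>\<tau>\<close>,
      values up to \<open>\<tau> / 2\<close> account for at most \<open>\<tau> / 2\<close> of it, so
      the mean of \<open>v\<close> is still at least \<open>\<tau> / 2\<close>.\<close>
    define v where "v x = w x * indicator {x. ennreal (\<tau> / 2) < w x} x" for x
    have v [measurable]: "v \<in> borel_measurable borel" unfolding v_def by measurable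
    \<comment> \<open>Twice the radius of the conclusion, so that the ball about an arbitrary
      \<open>x\<close> fits into one about a nearby point of \<open>D\<close>.\<close>
    define s where "s i = 2 * lam * (1/2) ^ i" for i :: nat
    have s: "0 < s i" for i using lam by (simp add: s_def)
    define bad where "bad = {(a, i). a \<in> D \<and> ennreal (\<tau> * measure m (ball a (s i))) < (\<integral>\<^sup>+y\<in>ball a (s i). w y \<partial>m)}"
    define I where "I = (\<lambda>(a, i). (a, s i)) ` bad"
    define E where "E = (\<Union>(a, r)\<in>I. ball a r)"
    have "countable bad"
      using D(1) by (intro countable_subset[of bad "D \<times> UNIV"]) (auto simp: bad_def)
    then have "countable I" by (simp add: I_def)
    moreover have "emeasure m (ball a (3 * r)) \<le> ennreal (2 * K1 / \<tau>) * emeasure (density m v) (ball a r)"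
      if "(a, r) \<in> I" for a r
    proof -
      from that have r: "0 < r" and bad: "ennreal (\<tau> * measure m (ball a r)) < (\<integral>\<^sup>+y\<in>ball a r. w y \<partial>m)"
        using s by (auto simp: I_def bad_def)
      define k where "k = emeasure (density m v) (ball a r)"
      have k: "k = (\<integral>\<^sup>+y\<in>ball a r. v y \<partial>m)"
        by (simp add: k_def emeasure_density)
      have "(\<integral>\<^sup>+y\<in>ball a r. w y \<partial>m) \<le> (\<integral>\<^sup>+y. v y * indicator (ball a r) y + ennreal (\<tau> / 2) * indicator (ball a r) y \<partial>m)"
        by (intro nn_integral_mono) (auto simp: v_def indicator_def not_less)
      also have "\<dots> = k + ennreal (\<tau> / 2) * emeasure m (ball a r)"
        by (simp add: nn_integral_add k nn_integral_cmult_indicator)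
      also have "\<dots> = k + ennreal (\<tau> / 2 * measure m (ball a r))"
        unfolding emeasure_ball using \<tau> by (subst ennreal_mult) auto
      finally have *: "ennreal (\<tau> * measure m (ball a r)) < k + ennreal (\<tau> / 2 * measure m (ball a r))"
        using bad by (rule less_le_trans[rotated])
      have "ennreal (\<tau> / 2 * measure m (ball a r)) \<le> k"
      proof (cases k)
        case (real c)
        then have "\<tau> * measure m (ball a r) < c + \<tau> / 2 * measure m (ball a r)"
          using * \<tau> by (simp add: ennreal_less_iff flip: ennreal_plus)
        then show ?thesis using real by (simp add: ennreal_leI)
      qed simp
      have "emeasure m (ball a (3 * r)) \<le> ennreal (K1 * measure m (ball a r))"
        unfolding emeasure_ball using r K1(2)[of r "3 * r" a a] by (intro ennreal_leI) auto
      also have "\<dots> = ennreal (2 * K1 / \<tau>) * ennreal (\<tau> / 2 * measure m (ball a r))"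
        using \<tau> K1(1) by (subst ennreal_mult[symmetric]) auto
      also have "\<dots> \<le> ennreal (2 * K1 / \<tau>) * k"
        by (intro mult_left_mono) (use \<open>ennreal (\<tau> / 2 * measure m (ball a r)) \<le> k\<close> in auto)
      finally show ?thesis by (simp add: k_def)
    qed
    ultimately have "emeasure m E \<le> ennreal (2 * K1 / \<tau>) * emeasure (density m v) E"
      unfolding E_def by (intro vitali_measure_le) (auto simp: sets_m)
    also have "emeasure (density m v) E \<le> emeasure (density m v) (space (density m v))"
      by (rule emeasure_space)
    also have "\<dots> = (\<integral>\<^sup>+x. v x \<partial>m)"
      by (subst emeasure_density) (auto intro!: nn_integral_cong)
    finally have "emeasure m E \<le> ennreal (2 * K1 / \<tau>) * (\<integral>\<^sup>+x. v x \<partial>m)"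
      by (simp add: mult_left_mono)
    moreover have "(\<integral>\<^sup>+y\<in>ball x (lam * (1/2)^i). w y \<partial>m)
         \<le> ennreal (2 * K1 * \<tau> * measure m (ball x (lam * (1/2)^i)))" if "x \<notin> E" for x i
    proof -
      define r where "r = lam * (1/2)^i"
      have r: "0 < r" "s i = 2 * r" using lam by (auto simp: r_def s_def)
      obtain a where a: "a \<in> D" "dist a x < r" using D(2)[OF r(1)] by blast
      \<comment> \<open>The point \<open>x\<close> itself lies in \<open>ball a (s i)\<close>, so a
        bad ball would put it into \<open>E\<close>.\<close>
      have "(a, i) \<notin> bad"
      proof
        assume "(a, i) \<in> bad"
        then have "(a, s i) \<in> I" by (force simp: I_def)
        then have "ball a (s i) \<subseteq> E" by (auto simp: E_def)
        then show False using that a(2) r by (auto simp: subset_iff)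
      qed
      then have "(\<integral>\<^sup>+y\<in>ball a (2 * r). w y \<partial>m) \<le> ennreal (\<tau> * measure m (ball a (2 * r)))"
        using a(1) r by (simp add: bad_def not_less)
      moreover have "ball x r \<subseteq> ball a (2 * r)"
      proof
        fix z assume "z \<in> ball x r"
        then show "z \<in> ball a (2 * r)"
          unfolding mem_ball using a(2) dist_triangle[of a z x] by linarith
      qed
      then have "(\<integral>\<^sup>+y\<in>ball x r. w y \<partial>m) \<le> (\<integral>\<^sup>+y\<in>ball a (2 * r). w y \<partial>m)"
        by (intro nn_integral_mono mult_left_mono) (auto simp: indicator_def)
      moreover have "\<tau> * measure m (ball a (2 * r)) \<le> 2 * K1 * \<tau> * measure m (ball x r)"
      proof -
        have "measure m (ball a (2 * r)) \<le> K1 * measure m (ball x r)"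
          using a(2) r by (intro K1) (auto simp: dist_commute)
        also have "\<dots> \<le> 2 * (K1 * measure m (ball x r))" using K1(1) by simp
        finally show ?thesis using \<tau> by simp
      qed
      ultimately show ?thesis
        unfolding r_def[symmetric] by (meson ennreal_leI order_trans)
    qed
    moreover have "E \<in> sets borel"
      unfolding E_def by (intro borel_open open_UN) auto
    ultimately show ?thesis
      by (intro bexI[of _ "- E"]) (auto simp: v_def)
  qed
  then show ?thesis using K1(1) by (intro that[of "2 * K1"]) auto
qed

section \<open>Hoelder limits of ball averages\<close>

lemma geometric_increments_limit:
  fixes a :: "nat \<Rightarrow> real"
  assumes "\<And>i. \<bar>a (Suc i) - a i\<bar> \<le> c * \<theta> ^ i" "0 \<le> \<theta>" "\<theta> < 1"
  obtains l where "\<And>i. \<bar>l - a i\<bar> \<le> c * \<theta> ^ i / (1 - \<theta>)"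
proof -
  have summ: "summable (\<lambda>i. c * \<theta> ^ (i + j))" for j
    using assms by (simp add: power_add summable_mult summable_mult2 summable_geometric flip: mult.assoc)
  have summ_a: "summable (\<lambda>i. a (Suc (i + j)) - a (i + j))" for j
    by (rule summable_comparison_test'[OF summ[of j]]) (use assms in auto)
  define l where "l = a 0 + (\<Sum>i. a (Suc i) - a i)"
  have "(\<lambda>n. \<Sum>i<n. a (Suc i) - a i) \<longlonglongrightarrow> (\<Sum>i. a (Suc i) - a i)"
    using summable_LIMSEQ[OF summ_a[of 0]] by simp
  then have "(\<lambda>n. a n - a 0) \<longlonglongrightarrow> (\<Sum>i. a (Suc i) - a i)"
    by (simp add: sum_lessThan_telescope)
  from tendsto_add[OF this tendsto_const[of "a 0"]] have lim: "a \<longlonglongrightarrow> l"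
    by (simp add: l_def add.commute)
  show ?thesis
  proof
    fix j
    have "(\<lambda>n. \<Sum>i<n. a (Suc (i + j)) - a (i + j)) \<longlonglongrightarrow> (\<Sum>i. a (Suc (i + j)) - a (i + j))"
      by (rule summable_LIMSEQ[OF summ_a])
    moreover have "(\<Sum>i<n. a (Suc (i + j)) - a (i + j)) = a (n + j) - a j" for n
      using sum_lessThan_telescope[of "\<lambda>i. a (i + j)" n] by simp
    moreover have "(\<lambda>n. a (n + j) - a j) \<longlonglongrightarrow> l - a j"
      by (rule tendsto_diff[OF LIMSEQ_ignore_initial_segment[OF lim] tendsto_const])
    ultimately have "l - a j = (\<Sum>i. a (Suc (i + j)) - a (i + j))"
      using LIMSEQ_unique by simp
    also have "\<bar>\<dots>\<bar> \<le> (\<Sum>i. c * \<theta> ^ (i + j))"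
      using norm_suminf_le[OF _ summ[of j], of "\<lambda>i. a (Suc (i + j)) - a (i + j)"] assms(1) by simp
    also have "\<dots> = (\<Sum>i. c * \<theta> ^ j * \<theta> ^ i)"
      by (simp add: power_add mult_ac)
    also have "\<dots> = c * \<theta> ^ j / (1 - \<theta>)"
      using assms by (subst suminf_mult) (auto simp: suminf_geometric summable_geometric)
    finally show "\<bar>l - a j\<bar> \<le> c * \<theta> ^ j / (1 - \<theta>)" .
  qed
qed

text \<open>After division by \<open>a + b\<close> this is \<open>t \<le> t powr \<beta>\<close> on
  the unit interval. It gives \<open>dist x y powr \<beta>\<close> the triangle inequality on which
  the McShane formula rests.\<close>

lemma powr_add_le_add_powr:
  fixes a b :: real
  assumes "0 \<le> a" "0 \<le> b" "0 < \<beta>" "\<beta> \<le> 1"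
  shows "(a + b) powr \<beta> \<le> a powr \<beta> + b powr \<beta>"
proof (cases "a + b = 0")
  case False
  then have pos: "0 < a + b" using assms by simp
  have *: "t \<le> t powr \<beta>" if "0 \<le> t" "t \<le> 1" for t :: real
    using that assms powr_mono'[of \<beta> 1 t] by simp
  have "1 = a / (a + b) + b / (a + b)"
    using pos by (simp flip: add_divide_distrib)
  also have "\<dots> \<le> (a / (a + b)) powr \<beta> + (b / (a + b)) powr \<beta>"
    using pos assms by (intro add_mono *) auto
  also have "\<dots> = (a powr \<beta> + b powr \<beta>) / (a + b) powr \<beta>"
    using assms by (simp add: powr_divide add_divide_distrib)
  finally show ?thesis using pos by (simp add: pos_le_divide_eq)
qed (use assms in auto)

text \<open>McShane's infimum formula for the distance \<open>dist x y powr \<beta>\<close>.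
  Clamping the result between \<open>- M\<close> and \<open>M\<close> adds the uniform bound, keeps
  the Hoelder constant and leaves the values on \<open>S\<close> alone.\<close>

lemma holder_extension:
  fixes l :: "'a::metric_space \<Rightarrow> real"
  assumes \<beta>: "0 < \<beta>" "\<beta> \<le> 1" and "0 \<le> L" "0 \<le> M"
    and l: "\<And>x y. x \<in> S \<Longrightarrow> y \<in> S \<Longrightarrow> \<bar>l x - l y\<bar> \<le> L * dist x y powr \<beta>"
    and M: "\<And>x. x \<in> S \<Longrightarrow> \<bar>l x\<bar> \<le> M"
  obtains u where "\<And>x. \<bar>u x\<bar> \<le> M" "\<And>x y. \<bar>u x - u y\<bar> \<le> L * dist x y powr \<beta>"
    "\<And>x. x \<in> S \<Longrightarrow> u x = l x"
proof (cases "S = {}")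
  case True
  then show ?thesis using assms by (intro that[of "\<lambda>x. 0"]) auto
next
  case False
  define v where "v x = (INF y\<in>S. l y + L * dist x y powr \<beta>)" for x
  have bdd: "bdd_below ((\<lambda>y. l y + L * dist x y powr \<beta>) ` S)" for x
  proof (rule bdd_belowI2)
    fix y assume "y \<in> S"
    then show "- M \<le> l y + L * dist x y powr \<beta>"
      using M[of y] \<open>0 \<le> L\<close> by (smt (verit) mult_nonneg_nonneg powr_ge_zero)
  qed
  have le: "v x \<le> v y + L * dist x y powr \<beta>" for x y
  proof -
    have "v x - L * dist x y powr \<beta> \<le> l z + L * dist y z powr \<beta>" if "z \<in> S" for z
    proof -
      have "v x \<le> l z + L * dist x z powr \<beta>"
        unfolding v_def by (rule cINF_lower[OF bdd that])
      also have "dist x z powr \<beta> \<le> (dist x y + dist y z) powr \<beta>"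
        using \<beta> dist_triangle by (intro powr_mono2) auto
      also have "\<dots> \<le> dist x y powr \<beta> + dist y z powr \<beta>"
        using \<beta> by (intro powr_add_le_add_powr) auto
      finally show ?thesis using \<open>0 \<le> L\<close> by (simp add: distrib_left mult_left_mono)
    qed
    then have "v x - L * dist x y powr \<beta> \<le> v y"
      unfolding v_def[of y] using False by (intro cINF_greatest)
    then show ?thesis by simp
  qed
  have eq: "v x = l x" if "x \<in> S" for x
  proof (rule antisym)
    show "v x \<le> l x"
      unfolding v_def using cINF_lower[OF bdd that, of x] by simp
    show "l x \<le> v x"
      unfolding v_def
    proof (rule cINF_greatest[OF False])
      fix y assume "y \<in> S"
      then show "l x \<le> l y + L * dist x y powr \<beta>"
        using l[OF that, of y] by simp
    qed
  qed
  show ?thesis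
  proof
    show "\<bar>max (- M) (min M (v x))\<bar> \<le> M" for x
      using \<open>0 \<le> M\<close> by auto
    show "\<bar>max (- M) (min M (v x)) - max (- M) (min M (v y))\<bar> \<le> L * dist x y powr \<beta>" for x y
      using le[of x y] le[of y x] by (simp add: dist_commute max_def min_def abs_if split: if_splits)
    show "max (- M) (min M (v x)) = l x" if "x \<in> S" for x
      using eq[OF that] M[OF that] by auto
  qed
qed

text \<open>Agrees with the mean \<open>fB\<close> of the Poincare inequality when \<open>g\<close>
  is \<open>\<lambda>y. real_of_ereal (f y)\<close>.\<close>

definition ball_avg :: "'a::metric_space measure \<Rightarrow> ('a \<Rightarrow> real) \<Rightarrow> 'a \<Rightarrow> real \<Rightarrow> real" where
  "ball_avg m g x r = (LINT y:ball x r|m. g y) / measure m (ball x r)"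

text \<open>The offsets fit the Hoelder estimate: for \<open>d = dist x y\<close> the ball of radius
  \<open>(1/2) ^ (i + 1)\<close> about \<open>y\<close> lies in the ball of radius
  \<open>(1/2) ^ i\<close> about \<open>x\<close>, while \<open>(1/2) ^ i\<close> is at most
  \<open>4 * d\<close>.\<close>

lemma ex_half_power_interval:
  fixes d :: real
  assumes "0 < d" "d < 1 / 2"
  obtains i where "(1/2) ^ (i + 2) \<le> d" "d < (1/2) ^ (i + 1)"
proof -
  define n where "n = (LEAST n. (1/2) ^ n \<le> d)"
  obtain n0 where "(1/2) ^ n0 < d" using real_arch_pow_inv[of d "1/2"] assms by auto
  then have n: "(1/2) ^ n \<le> d"
    unfolding n_def by (intro LeastI[of "\<lambda>n. (1/2) ^ n \<le> d" n0] less_imp_le)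
  have less: "d < (1/2) ^ k" if "k < n" for k
    using not_less_Least[of k "\<lambda>n. (1/2) ^ n \<le> d"] that by (simp add: n_def)
  have "n \<noteq> 0" "n \<noteq> 1" by (rule notI, use n assms in simp)+
  then have "n = (n - 2) + 2" by simp
  then obtain i where "n = i + 2" by blast
  then show ?thesis using that[of i] n less[of "i + 1"] by simp
qed

lemma holder_imp_continuous:
  fixes u :: "'a::metric_space \<Rightarrow> real"
  assumes "0 < \<beta>" and hol: "\<And>x y. \<bar>u x - u y\<bar> \<le> L * dist x y powr \<beta>"
  shows "continuous_on A u"
proof (rule continuous_at_imp_continuous_on, rule ballI)
  fix x :: 'a
  have "((\<lambda>y. L * dist y x powr \<beta>) \<longlongrightarrow> L * 0 powr \<beta>) (at x)"
    using assms(1) tendsto_dist_iff[of "\<lambda>y. y" x "at x"]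
    by (intro tendsto_mult tendsto_const tendsto_powr') auto
  then have lim: "((\<lambda>y. L * dist y x powr \<beta>) \<longlongrightarrow> 0) (at x)" by simp
  have "((\<lambda>y. dist (u y) (u x)) \<longlongrightarrow> 0) (at x)"
    by (rule tendsto_sandwich[OF _ _ tendsto_const lim])
      (intro always_eventually allI zero_le_dist, intro always_eventually allI, simp only: dist_real_def hol)
  then show "isCont u x"
    by (simp add: isCont_def tendsto_dist_iff[of u])
qed

context doubling_space
begin

text \<open>Any constant \<open>c\<close> may be tested, in particular the average over a larger
  ball; this is how averages over nested balls are compared.\<close>

lemma ball_avg_diff_le:
  assumes "set_integrable m (ball z s) g" "0 < s"
    and le: "(\<integral>\<^sup>+y\<in>ball z s. ennreal \<bar>g y - c\<bar> \<partial>m) \<le> ennreal (B * measure m (ball z s))" and "0 \<le> B"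
  shows "\<bar>ball_avg m g z s - c\<bar> \<le> B"
proof -
  have c: "set_integrable m (ball z s) (\<lambda>y. c)"
    unfolding set_integrable_def using emeasure_ball_finite by simp
  have int: "set_integrable m (ball z s) (\<lambda>y. g y - c)"
    using assms(1) c by (rule set_integral_diff)
  have "(LINT y:ball z s|m. g y - c) = (LINT y:ball z s|m. g y) - (LINT y:ball z s|m. c)"
    using assms(1) c by (rule set_integral_diff)
  also have "(LINT y:ball z s|m. c) = c * measure m (ball z s)"
    by (simp add: set_lebesgue_integral_def mult.commute)
  also have "(LINT y:ball z s|m. g y) - c * measure m (ball z s) = (ball_avg m g z s - c) * measure m (ball z s)"
    using measure_ball_pos[OF \<open>0 < s\<close>, of z] by (simp add: ball_avg_def field_simps)
  finally have "ennreal \<bar>(ball_avg m g z s - c) * measure m (ball z s)\<bar> = ennreal (norm (LINT y:ball z s|m. g y - c))"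
    by simp
  also have "\<dots> \<le> (\<integral>\<^sup>+y. norm (indicator (ball z s) y *\<^sub>R (g y - c)) \<partial>m)"
    using int unfolding set_integrable_def set_lebesgue_integral_def by (rule integral_norm_bound_ennreal)
  also have "\<dots> = (\<integral>\<^sup>+y\<in>ball z s. ennreal \<bar>g y - c\<bar> \<partial>m)"
    by (intro nn_integral_cong) (auto simp: indicator_def)
  also note le
  finally have "\<bar>ball_avg m g z s - c\<bar> * measure m (ball z s) \<le> B * measure m (ball z s)"
    using \<open>0 \<le> B\<close> by (simp add: abs_mult)
  then show ?thesis using measure_ball_pos[OF \<open>0 < s\<close>, of z] by simp
qed

text \<open>Where the mean oscillations decay at rate \<open>\<beta>\<close>, the ball averages converge to a
  \<open>\<beta>\<close>-Hoelder function. That it agrees with \<open>g\<close> almost everywhere follows from a covering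
  argument, without a Lebesgue differentiation theorem.\<close>
lemma campanato:
  assumes \<beta>: "0 < \<beta>" "\<beta> \<le> 1"
  obtains K where "0 \<le> K"
    and "\<And>g S A. g \<in> borel_measurable borel \<Longrightarrow> S \<in> sets borel \<Longrightarrow>
      (\<And>x r. set_integrable m (ball x r) g) \<Longrightarrow> 0 \<le> A \<Longrightarrow>
      (\<And>x i. x \<in> S \<Longrightarrow> (\<integral>\<^sup>+y\<in>ball x ((1/2)^i). ennreal \<bar>g y - ball_avg m g x ((1/2)^i)\<bar> \<partial>m)
         \<le> ennreal (A * ((1/2) powr \<beta>) ^ i * measure m (ball x ((1/2)^i)))) \<Longrightarrow>
      (\<And>x. x \<in> S \<Longrightarrow> \<bar>ball_avg m g x 1\<bar> \<le> A) \<Longrightarrow>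
      \<exists>u. (\<forall>x. \<bar>u x\<bar> \<le> K * A) \<and> (\<forall>x y. \<bar>u x - u y\<bar> \<le> K * A * dist x y powr \<beta>) \<and>
        (AE x in m. x \<in> S \<longrightarrow> g x = u x)"
proof -
  define \<theta> where "\<theta> = (1/2 :: real) powr \<beta>"
  have \<theta>: "0 < \<theta>" "\<theta> < 1"
    using \<beta> powr_less_mono'[of "1/2" 0 \<beta>] by (auto simp: \<theta>_def)
  have \<theta>_pow: "((1/2) ^ i) powr \<beta> = \<theta> ^ i" for i :: nat
  proof -
    have "((1/2) ^ i) powr \<beta> = ((1/2) powr real i) powr \<beta>" by (subst powr_realpow) auto
    also have "\<dots> = \<theta> powr real i" by (simp only: \<theta>_def powr_powr mult.commute)
    also have "\<dots> = \<theta> ^ i" using \<theta> by (intro powr_realpow)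
    finally show ?thesis .
  qed
  \<comment> \<open>The ratio 5 is dictated by the covering argument below: a ball of radius
    \<open>4 * s\<close> about \<open>x\<close> is compared with one of radius \<open>s\<close>
    about a point at distance less than \<open>s\<close>.\<close>
  obtain K1 where K1: "1 \<le> K1" "\<And>x y r s. 0 < r \<Longrightarrow> s + dist x y \<le> 5 * r \<Longrightarrow> measure m (ball y s) \<le> K1 * measure m (ball x r)"
    using measure_ball_scale_le by blast
  define K2 where "K2 = K1 / (1 - \<theta>)"
  have K2: "0 \<le> K2" using K1 \<theta> by (simp add: K2_def)
  \<comment> \<open>For close points the errors add up to \<open>2 * K2 + K1\<close>, for points at
    distance at least \<open>1 / 2\<close> the uniform bounds add up to \<open>2 + 2 * K2\<close>.
    The denominator pays for \<open>dist x y\<close> being as small as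
    \<open>(1/2) ^ (i + 2)\<close>.\<close>
  define K3 where "K3 = (2 + 2 * K2 + K1) / \<theta>\<^sup>2"
  have K3: "0 \<le> K3" using K1 K2 by (simp add: K3_def)
  obtain D :: "'a set" where D: "countable D" "\<And>x \<epsilon>. 0 < \<epsilon> \<Longrightarrow> \<exists>a\<in>D. dist a x < \<epsilon>"
    using countable_dense by blast
  have "\<exists>u. (\<forall>x. \<bar>u x\<bar> \<le> K3 * A) \<and> (\<forall>x y. \<bar>u x - u y\<bar> \<le> K3 * A * dist x y powr \<beta>) \<and>
        (AE x in m. x \<in> S \<longrightarrow> g x = u x)"
    if g [measurable]: "g \<in> borel_measurable borel" and S [measurable]: "S \<in> sets borel"
      and int: "\<And>x r. set_integrable m (ball x r) g" and A: "0 \<le> A"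
      and osc: "\<And>x i. x \<in> S \<Longrightarrow> (\<integral>\<^sup>+y\<in>ball x ((1/2)^i). ennreal \<bar>g y - ball_avg m g x ((1/2)^i)\<bar> \<partial>m)
         \<le> ennreal (A * \<theta> ^ i * measure m (ball x ((1/2)^i)))"
      and avg: "\<And>x. x \<in> S \<Longrightarrow> \<bar>ball_avg m g x 1\<bar> \<le> A" for g S A
  proof -
    note [measurable_cong] = sets_m
    define a where "a x i = ball_avg m g x ((1/2) ^ i)" for x and i :: nat
    \<comment> \<open>Covers both comparisons that follow: consecutive radii at one centre, and
      neighbouring centres at consecutive radii.\<close>
    have near: "\<bar>ball_avg m g y s - a x i\<bar> \<le> A * K1 * \<theta> ^ i"
      if "x \<in> S" "0 < s" "s + dist x y \<le> (1/2) ^ i" "(1/2) ^ i + dist x y \<le> 5 * s" for x y s i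
    proof (rule ball_avg_diff_le[OF int that(2)])
      have "ball y s \<subseteq> ball x ((1/2) ^ i)"
      proof
        fix z assume "z \<in> ball y s"
        then show "z \<in> ball x ((1/2) ^ i)"
          unfolding mem_ball using that(3) dist_triangle[of x z y] by linarith
      qed
      then have "(\<integral>\<^sup>+z\<in>ball y s. ennreal \<bar>g z - a x i\<bar> \<partial>m) \<le> (\<integral>\<^sup>+z\<in>ball x ((1/2)^i). ennreal \<bar>g z - a x i\<bar> \<partial>m)"
        by (intro nn_integral_mono mult_left_mono) (auto simp: indicator_def)
      also have "\<dots> \<le> ennreal (A * \<theta> ^ i * measure m (ball x ((1/2)^i)))"
        unfolding a_def by (rule osc[OF that(1)])
      also have "\<dots> \<le> ennreal (A * \<theta> ^ i * (K1 * measure m (ball y s)))"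
        using that A \<theta> by (intro ennreal_leI mult_left_mono K1) (auto simp: dist_commute)
      finally show "(\<integral>\<^sup>+z\<in>ball y s. ennreal \<bar>g z - a x i\<bar> \<partial>m) \<le> ennreal (A * K1 * \<theta> ^ i * measure m (ball y s))"
        by (simp add: mult_ac)
    qed (use A K1 \<theta> in auto)
    have "\<exists>l. \<forall>i. \<bar>l - a x i\<bar> \<le> A * K2 * \<theta> ^ i" if "x \<in> S" for x
    proof -
      have "\<bar>a x (Suc i) - a x i\<bar> \<le> A * K1 * \<theta> ^ i" for i
        unfolding a_def[of x "Suc i"] using that by (intro near) auto
      then obtain l where "\<And>i. \<bar>l - a x i\<bar> \<le> A * K1 * \<theta> ^ i / (1 - \<theta>)"
        using geometric_increments_limit[of "a x" "A * K1" \<theta>] \<theta> by auto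
      then show ?thesis by (intro exI[of _ l]) (simp add: K2_def)
    qed
    then obtain l where l: "\<And>x i. x \<in> S \<Longrightarrow> \<bar>l x - a x i\<bar> \<le> A * K2 * \<theta> ^ i"
      by metis
    have l_bound: "\<bar>l x\<bar> \<le> A * (1 + K2)" if "x \<in> S" for x
      using l[OF that, of 0] avg[OF that] by (simp add: a_def distrib_left)
    have \<theta>2: "\<theta>\<^sup>2 \<le> 1" "\<theta>\<^sup>2 \<le> \<theta>" using \<theta> power_decreasing[of 1 2 \<theta>] by (auto simp: power_le_one)
    have hol: "\<bar>l x - l y\<bar> \<le> K3 * A * dist x y powr \<beta>" if xy: "x \<in> S" "y \<in> S" for x y
    proof (cases "x = y \<or> 1 / 2 \<le> dist x y")
      case True
      show ?thesis
      proof (cases "x = y")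
        case False
        then have "(1/2) powr \<beta> \<le> dist x y powr \<beta>"
          using True \<beta> by (intro powr_mono2) auto
        then have "\<theta>\<^sup>2 \<le> dist x y powr \<beta>" using \<theta>2 by (simp add: \<theta>_def)
        have "\<bar>l x - l y\<bar> \<le> A * (2 + 2 * K2)"
          using l_bound[OF xy(1)] l_bound[OF xy(2)] by (simp add: algebra_simps)
        also have "\<dots> \<le> A * (2 + 2 * K2 + K1)"
          using A K1 by (intro mult_left_mono) auto
        also have "\<dots> = K3 * A * \<theta>\<^sup>2" using \<theta> by (simp add: K3_def)
        also have "\<dots> \<le> K3 * A * dist x y powr \<beta>"
          using \<open>\<theta>\<^sup>2 \<le> dist x y powr \<beta>\<close> A K3 by (intro mult_left_mono) auto
        finally show ?thesis .
      qed simp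
    next
      case False
      then obtain i where i: "(1/2) ^ (i + 2) \<le> dist x y" "dist x y < (1/2) ^ (i + 1)"
        using ex_half_power_interval[of "dist x y"] by auto
      have "\<bar>a y (i + 1) - a x i\<bar> \<le> A * K1 * \<theta> ^ i"
        unfolding a_def[of y] using i xy by (intro near) auto
      moreover have "A * K2 * \<theta> ^ (i + 1) \<le> A * K2 * \<theta> ^ i"
        using A K2 \<theta> by (intro mult_left_mono power_decreasing) auto
      ultimately have "\<bar>l x - l y\<bar> \<le> A * K2 * \<theta> ^ i + A * K2 * \<theta> ^ i + A * K1 * \<theta> ^ i"
        using l[OF xy(1), of i] l[OF xy(2), of "i + 1"] by linarith
      also have "\<dots> = A * (2 * K2 + K1) * \<theta> ^ i" by (simp add: algebra_simps)
      also have "\<dots> \<le> A * (2 + 2 * K2 + K1) * \<theta> ^ i"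
        using A \<theta> by (intro mult_left_mono mult_right_mono) auto
      also have "\<dots> = K3 * A * \<theta> ^ (i + 2)"
        using \<theta> by (simp add: K3_def power_add power2_eq_square)
      also have "\<theta> ^ (i + 2) \<le> dist x y powr \<beta>"
        unfolding \<theta>_pow[symmetric] using i \<beta> by (intro powr_mono2) auto
      finally show ?thesis using A K3 by (simp add: mult_left_mono)
    qed
    have "\<bar>l x\<bar> \<le> K3 * A" if "x \<in> S" for x
    proof -
      have "1 + K2 \<le> 2 + 2 * K2 + K1" using K1 K2 by simp
      also have "\<dots> = K3 * \<theta>\<^sup>2" using \<theta> by (simp add: K3_def)
      also have "\<dots> \<le> K3 * 1" using K3 \<theta>2 by (intro mult_left_mono) auto
      finally have "A * (1 + K2) \<le> A * K3" using A by (intro mult_left_mono) auto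
      then show ?thesis using l_bound[OF that] by (simp add: mult.commute)
    qed
    then obtain u where u: "\<And>x. \<bar>u x\<bar> \<le> K3 * A" "\<And>x y. \<bar>u x - u y\<bar> \<le> K3 * A * dist x y powr \<beta>"
      "\<And>x. x \<in> S \<Longrightarrow> u x = l x"
      using holder_extension[OF \<beta>, of "K3 * A" "K3 * A" S l] hol A K3 by auto
    have [measurable]: "u \<in> borel_measurable borel"
      using \<beta> u(2) by (intro borel_measurable_continuous_onI holder_imp_continuous)
    \<comment> \<open>The aim is that \<open>\<nu>\<close> vanishes on \<open>S\<close>. Covering at
      scale \<open>(1/2) ^ i\<close> bounds it on bounded parts of \<open>S\<close> by a multiple of
      \<open>\<theta> ^ i\<close>, for every \<open>i\<close>.\<close>
    define \<nu> where "\<nu> = density m (\<lambda>y. ennreal \<bar>g y - u y\<bar>)"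
    have \<nu>: "sets \<nu> = sets borel" by (simp add: \<nu>_def sets_m)
    define K4 where "K4 = A * (1 + K2 + K3) * K1"
    have K4: "0 \<le> K4" using A K1 K2 K3 by (simp add: K4_def)
    have bound: "emeasure \<nu> (S \<inter> ball x0 R) \<le> ennreal (K4 * \<theta> ^ i) * emeasure m (ball x0 (R + 1))" for x0 R i
    proof -
      \<comment> \<open>A quarter of the scale: if \<open>dist b x < s\<close>, then
        \<open>ball b (3 * s)\<close> lies in the ball of radius \<open>4 * s = (1/2) ^ i\<close>
        about \<open>x\<close>, where the oscillation is controlled. The bound
        \<open>2 * s < 1\<close> keeps the covering inside \<open>ball x0 (R + 1)\<close>.\<close>
      define s where "s = (1/2 :: real) ^ i / 4"
      have s: "0 < s" "2 * s < 1" using power_le_one[of "1/2::real" i] by (auto simp: s_def)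
      define I where "I = (\<lambda>a. (a, s)) ` {a \<in> D. ball a s \<inter> S \<inter> ball x0 R \<noteq> {}}"
      have "countable I" using D(1) by (simp add: I_def)
      have "S \<inter> ball x0 R \<subseteq> (\<Union>(a, r)\<in>I. ball a r)"
      proof
        fix x assume x: "x \<in> S \<inter> ball x0 R"
        obtain a where "a \<in> D" "dist a x < s" using D(2)[OF s(1)] by blast
        with x have "(a, s) \<in> I" by (force simp: I_def)
        with \<open>dist a x < s\<close> show "x \<in> (\<Union>(a, r)\<in>I. ball a r)"
          by force
      qed
      then have "emeasure \<nu> (S \<inter> ball x0 R) \<le> emeasure \<nu> (\<Union>(a, r)\<in>I. ball a r)"
        by (intro emeasure_mono) (auto simp: \<nu> intro!: borel_open)
      also have "\<dots> \<le> ennreal (K4 * \<theta> ^ i) * emeasure m (\<Union>(a, r)\<in>I. ball a r)"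
      proof (rule vitali_measure_le[OF \<nu> sets_m \<open>countable I\<close>])
        fix b r assume "(b, r) \<in> I"
        then obtain x where r: "r = s" and x: "dist b x < s" "x \<in> S"
          by (auto simp: I_def)
        have s4: "4 * s = (1/2) ^ i" by (simp add: s_def)
        have "emeasure \<nu> (ball b (3 * r)) \<le> emeasure \<nu> (ball x ((1/2) ^ i))"
        proof (rule emeasure_mono)
          show "ball b (3 * r) \<subseteq> ball x ((1/2) ^ i)"
          proof
            fix z assume "z \<in> ball b (3 * r)"
            then show "z \<in> ball x ((1/2) ^ i)"
              unfolding mem_ball s4[symmetric] r using x(1) dist_triangle2[of x z b] by (simp add: dist_commute)
          qed
        qed (simp add: \<nu>)
        also have "\<dots> = (\<integral>\<^sup>+y\<in>ball x ((1/2) ^ i). ennreal \<bar>g y - u y\<bar> \<partial>m)"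
          unfolding \<nu>_def by (rule emeasure_density) auto
        also have "\<dots> \<le> (\<integral>\<^sup>+y. ennreal \<bar>g y - a x i\<bar> * indicator (ball x ((1/2) ^ i)) y
            + ennreal (A * (K2 + K3) * \<theta> ^ i) * indicator (ball x ((1/2) ^ i)) y \<partial>m)"
        proof (rule nn_integral_mono)
          fix y
          show "ennreal \<bar>g y - u y\<bar> * indicator (ball x ((1/2) ^ i)) y \<le> ennreal \<bar>g y - a x i\<bar> * indicator (ball x ((1/2) ^ i)) y
            + ennreal (A * (K2 + K3) * \<theta> ^ i) * indicator (ball x ((1/2) ^ i)) y"
          proof (cases "y \<in> ball x ((1/2) ^ i)")
            case True
            have "dist x y powr \<beta> \<le> \<theta> ^ i"
              unfolding \<theta>_pow[symmetric] using True \<beta> by (intro powr_mono2) auto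
            then have "K3 * A * dist x y powr \<beta> \<le> K3 * A * \<theta> ^ i"
              using K3 A by (intro mult_left_mono) auto
            then have "\<bar>g y - u y\<bar> \<le> \<bar>g y - a x i\<bar> + A * (K2 + K3) * \<theta> ^ i"
              using l[OF x(2), of i] u(2)[of x y] u(3)[OF x(2)] by (simp add: algebra_simps)
            then show ?thesis
              using True A K2 K3 \<theta> by (simp add: ennreal_leI flip: ennreal_plus)
          qed simp
        qed
        also have "\<dots> = (\<integral>\<^sup>+y\<in>ball x ((1/2) ^ i). ennreal \<bar>g y - a x i\<bar> \<partial>m)
            + ennreal (A * (K2 + K3) * \<theta> ^ i) * emeasure m (ball x ((1/2) ^ i))"
          by (simp add: nn_integral_add nn_integral_cmult_indicator)
        also have "\<dots> \<le> ennreal (A * \<theta> ^ i * measure m (ball x ((1/2)^i)))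
            + ennreal (A * (K2 + K3) * \<theta> ^ i) * ennreal (measure m (ball x ((1/2) ^ i)))"
          unfolding a_def emeasure_ball by (intro add_right_mono osc x)
        also have "\<dots> = ennreal (A * (1 + K2 + K3) * \<theta> ^ i * measure m (ball x ((1/2) ^ i)))"
          using A K2 K3 \<theta> by (simp add: distrib_left distrib_right flip: ennreal_mult ennreal_plus)
        also have "\<dots> \<le> ennreal (A * (1 + K2 + K3) * \<theta> ^ i * (K1 * measure m (ball b s)))"
          using A K2 K3 \<theta> x s s4 by (intro ennreal_leI mult_left_mono K1) auto
        also have "\<dots> = ennreal (K4 * \<theta> ^ i) * emeasure m (ball b r)"
          unfolding emeasure_ball r using K4 \<theta>
          by (subst ennreal_mult[symmetric]) (simp_all add: K4_def[symmetric], simp add: K4_def mult_ac)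
        finally show "emeasure \<nu> (ball b (3 * r)) \<le> ennreal (K4 * \<theta> ^ i) * emeasure m (ball b r)" .
      qed
      also have "\<dots> \<le> ennreal (K4 * \<theta> ^ i) * emeasure m (ball x0 (R + 1))"
      proof (intro mult_left_mono emeasure_mono ball_sets)
        show "(\<Union>(a, r)\<in>I. ball a r) \<subseteq> ball x0 (R + 1)"
        proof
          fix z assume "z \<in> (\<Union>(a, r)\<in>I. ball a r)"
          then obtain b x where "dist b x < s" "dist x0 x < R" "dist b z < s"
            by (auto simp: I_def)
          then show "z \<in> ball x0 (R + 1)"
            unfolding mem_ball using s dist_triangle[of x0 z x] dist_triangle[of x z b] dist_commute[of x b] by linarith
        qed
      qed auto
      finally show ?thesis .
    qed
    have zero: "emeasure \<nu> (S \<inter> ball x0 R) = 0" for x0 R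
    proof -
      have "(\<lambda>i. K4 * \<theta> ^ i * measure m (ball x0 (R + 1))) \<longlonglongrightarrow> K4 * 0 * measure m (ball x0 (R + 1))"
        using \<theta> by (intro tendsto_mult tendsto_const LIMSEQ_power_zero) auto
      then have "(\<lambda>i. ennreal (K4 * \<theta> ^ i * measure m (ball x0 (R + 1)))) \<longlonglongrightarrow> ennreal 0"
        by (intro tendsto_ennrealI) simp
      then have "emeasure \<nu> (S \<inter> ball x0 R) \<le> ennreal 0"
      proof (rule LIMSEQ_le_const, intro exI[of _ 0] allI impI)
        fix i show "emeasure \<nu> (S \<inter> ball x0 R) \<le> ennreal (K4 * \<theta> ^ i * measure m (ball x0 (R + 1)))"
          using bound[of x0 R i] K4 \<theta> unfolding emeasure_ball by (subst ennreal_mult) auto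
      qed
      then show ?thesis by simp
    qed
    have "AE x in m. x \<in> S \<inter> ball x0 (real k) \<longrightarrow> g x = u x" for x0 and k :: nat
    proof -
      have "(\<integral>\<^sup>+y. ennreal \<bar>g y - u y\<bar> * indicator (S \<inter> ball x0 (real k)) y \<partial>m) = 0"
        using zero[of x0 "real k"] unfolding \<nu>_def by (subst (asm) emeasure_density) auto
      then have "AE y in m. ennreal \<bar>g y - u y\<bar> * indicator (S \<inter> ball x0 (real k)) y = 0"
        by (subst (asm) nn_integral_0_iff_AE) auto
      then show ?thesis by eventually_elim (auto simp: indicator_def split: if_splits)
    qed
    \<comment> \<open>\<open>undefined\<close> is just some centre; balls of integer radius about it
      exhaust the space.\<close>
    then have "AE x in m. \<forall>k::nat. x \<in> S \<inter> ball undefined (real k) \<longrightarrow> g x = u x"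
      by (subst AE_all_countable) blast
    then have "AE x in m. x \<in> S \<longrightarrow> g x = u x"
    proof eventually_elim
      case (elim x)
      obtain k where "dist undefined x < real k" using reals_Archimedean2 by blast
      then show ?case using elim by auto
    qed
    then show ?thesis using u(1,2) by blast
  qed
  then show ?thesis using K3 by (intro that[of K3]) (auto simp: \<theta>_def)
qed

end

section \<open>Truncation\<close>

lemma epow_ereal: "epow (ereal x) p = ennreal (\<bar>x\<bar> powr p)"
  by (simp add: epow_def e2ennreal_ereal enn_powr_ennreal)

lemma epow_infinite: "\<bar>v\<bar> = \<infinity> \<Longrightarrow> epow v p = \<infinity>"
  by (simp add: epow_def)

lemma ennreal_powr_add_le:
  assumes "0 \<le> a" "0 \<le> b" "0 \<le> p"
  shows "ennreal ((a + b) powr p) \<le> ennreal (2 powr p) * (ennreal (a powr p) + ennreal (b powr p))"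
  using enn_powr_add_le[of p "ennreal a" "ennreal b"] assms
  by (simp add: enn_powr_ennreal flip: ennreal_plus)

lemma epow_le_diff:
  assumes "0 \<le> p"
  shows "epow (ereal b) p \<le> ennreal (2 powr p) * (epow v p + epow (v - ereal b) p)"
proof (cases v)
  case (real a)
  have "ennreal (\<bar>b\<bar> powr p) \<le> ennreal ((\<bar>a\<bar> + \<bar>a - b\<bar>) powr p)"
    using assms by (intro ennreal_leI powr_mono2) auto
  also have "\<dots> \<le> ennreal (2 powr p) * (ennreal (\<bar>a\<bar> powr p) + ennreal (\<bar>a - b\<bar> powr p))"
    using assms by (intro ennreal_powr_add_le) auto
  finally show ?thesis using real by (simp add: epow_ereal)
qed (auto simp: epow_infinite ennreal_mult_top)

text \<open>Above the level, \<open>\<bar>v\<bar>\<close> is its power \<open>1 - p\<close> times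
  its power \<open>p\<close>, and the former is at most \<open>l powr (1 - p)\<close>. This replaces
  Jensen's inequality: if the mean of the \<open>p\<close>-th power is of order
  \<open>l powr p\<close>, the mean is of order \<open>l\<close>.\<close>

lemma abs_le_level_plus_epow:
  assumes "1 \<le> p" "0 < l"
  shows "e2ennreal \<bar>v\<bar> \<le> ennreal l + ennreal (l powr (1 - p)) * epow v p"
proof (cases "\<bar>v\<bar> = \<infinity>")
  case True
  then show ?thesis using assms by (simp add: epow_infinite ennreal_mult_top)
next
  case False
  then obtain a where v: "v = ereal a" by (cases v) auto
  have "\<bar>a\<bar> \<le> l + l powr (1 - p) * \<bar>a\<bar> powr p"
  proof (cases "\<bar>a\<bar> \<le> l")
    case False
    then have "\<bar>a\<bar> powr (1 - p) \<le> l powr (1 - p)"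
      using assms by (intro powr_mono2') auto
    then have "\<bar>a\<bar> powr (1 - p) * \<bar>a\<bar> powr p \<le> l powr (1 - p) * \<bar>a\<bar> powr p"
      by (rule mult_right_mono) simp
    moreover have "\<bar>a\<bar> powr (1 - p) * \<bar>a\<bar> powr p = \<bar>a\<bar>"
      using False assms by (simp flip: powr_add)
    ultimately show ?thesis using assms by simp
  qed (simp add: add_increasing2)
  then show ?thesis
    using assms unfolding v epow_ereal
    by (simp add: e2ennreal_ereal flip: ennreal_mult ennreal_plus)
qed

lemma diameter_ball_le:
  fixes x :: "'a::metric_space"
  assumes "0 < r"
  shows "diameter (ball x r) \<le> 2 * r"
proof -
  have "dist y z \<le> 2 * r" if "y \<in> ball x r" "z \<in> ball x r" for y z
    using that dist_triangle3[of y z x] by simp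
  then show ?thesis
    unfolding diameter_def using assms by (auto intro!: cSUP_least)
qed

context doubling_space
begin

lemma oscillation_le_of_poincare:
  fixes f :: "'a \<Rightarrow> ereal"
  assumes ineq: "(\<integral>\<^sup>+ y\<in>ball x r. epow (f y - ereal (ball_avg m (\<lambda>y. real_of_ereal (f y)) x r)) 1 \<partial>m) / emeasure m (ball x r)
       \<le> ennreal (C * diameter (ball x r) powr \<beta>) *
         enn_powr ((\<integral>\<^sup>+ y\<in>ball x (lam * r). enn_powr (\<rho> y) p \<partial>m) / emeasure m (ball x (lam * r))) (1 / p)"
    and f [measurable]: "f \<in> borel_measurable borel"
    and "0 < C" "0 < \<beta>" "0 < r" "0 < lam" "0 < p" "0 \<le> \<Lambda>"
    and le: "(\<integral>\<^sup>+ y\<in>ball x (lam * r). enn_powr (\<rho> y) p \<partial>m) \<le> ennreal (\<Lambda> powr p * measure m (ball x (lam * r)))"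
  shows "(\<integral>\<^sup>+y\<in>ball x r. ennreal \<bar>real_of_ereal (f y) - ball_avg m (\<lambda>y. real_of_ereal (f y)) x r\<bar> \<partial>m)
       \<le> ennreal (C * (2 * r) powr \<beta> * \<Lambda> * measure m (ball x r))"
proof -
  let ?c = "ball_avg m (\<lambda>y. real_of_ereal (f y)) x r"
  define J where "J = (\<integral>\<^sup>+ y\<in>ball x r. epow (f y - ereal ?c) 1 \<partial>m)"
  have pos: "0 < measure m (ball x r)" "0 < measure m (ball x (lam * r))"
    using assms by (auto intro!: measure_ball_pos)
  have "(\<integral>\<^sup>+ y\<in>ball x (lam * r). enn_powr (\<rho> y) p \<partial>m) / emeasure m (ball x (lam * r)) \<le> ennreal (\<Lambda> powr p)"
    unfolding emeasure_ball using pos le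
    by (intro divide_le_posI_ennreal) (auto simp: mult.commute simp flip: ennreal_mult)
  then have "enn_powr ((\<integral>\<^sup>+ y\<in>ball x (lam * r). enn_powr (\<rho> y) p \<partial>m) / emeasure m (ball x (lam * r))) (1 / p)
      \<le> enn_powr (ennreal (\<Lambda> powr p)) (1 / p)"
    using assms by (intro enn_powr_mono) auto
  also have "\<dots> = ennreal \<Lambda>"
    using assms by (simp add: enn_powr_ennreal powr_powr)
  finally have *: "enn_powr ((\<integral>\<^sup>+ y\<in>ball x (lam * r). enn_powr (\<rho> y) p \<partial>m) / emeasure m (ball x (lam * r))) (1 / p) \<le> ennreal \<Lambda>" .
  have "diameter (ball x r) powr \<beta> \<le> (2 * r) powr \<beta>"
    using assms diameter_ball_le[of r x] by (intro powr_mono2 diameter_ge_0) auto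
  then have "ennreal (C * diameter (ball x r) powr \<beta>) \<le> ennreal (C * (2 * r) powr \<beta>)"
    using assms by (intro ennreal_leI mult_left_mono) auto
  with * have "J / emeasure m (ball x r) \<le> ennreal (C * (2 * r) powr \<beta>) * ennreal \<Lambda>"
    unfolding J_def using ineq by (meson mult_mono' order_trans zero_le)
  also have "\<dots> = ennreal (C * (2 * r) powr \<beta> * \<Lambda>)"
    using assms by (subst ennreal_mult) auto
  finally have "J / emeasure m (ball x r) * emeasure m (ball x r) \<le> ennreal (C * (2 * r) powr \<beta> * \<Lambda>) * emeasure m (ball x r)"
    by (rule mult_right_mono) simp
  also have "J / emeasure m (ball x r) * emeasure m (ball x r) = J"
    using pos unfolding emeasure_ball by (simp add: ennreal_divide_times)
  also have "ennreal (C * (2 * r) powr \<beta> * \<Lambda>) * emeasure m (ball x r) = ennreal (C * (2 * r) powr \<beta> * \<Lambda> * measure m (ball x r))"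
    unfolding emeasure_ball using assms by (subst ennreal_mult[symmetric]) auto
  finally have J: "J \<le> ennreal (C * (2 * r) powr \<beta> * \<Lambda> * measure m (ball x r))" .
  \<comment> \<open>At infinite \<open>v\<close> the left side uses the default value 0 of
    \<open>real_of_ereal\<close>, while the right side is infinite.\<close>
  have "ennreal \<bar>real_of_ereal v - c\<bar> \<le> epow (v - ereal c) 1" for v c
  proof (cases v)
    case (real a)
    then show ?thesis by (simp add: epow_ereal)
  qed (auto simp: epow_infinite)
  then have "(\<integral>\<^sup>+y\<in>ball x r. ennreal \<bar>real_of_ereal (f y) - ?c\<bar> \<partial>m) \<le> J"
    unfolding J_def by (intro nn_integral_mono mult_right_mono) auto
  then show ?thesis using J by (rule order_trans)
qed

text \<open>The two summands of \<open>w\<close> have separate tasks: the gradient part controls the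
  oscillations through the Poincare inequality, the part coming from \<open>f\<close> controls the
  averages at radius 1 and thereby the size of \<open>u\<close>. The constant \<open>K\<close> is
  fixed before the level \<open>l\<close>.\<close>

lemma lipschitz_truncation:
  fixes f :: "'a \<Rightarrow> ereal" and \<Gamma> :: "(real \<Rightarrow> 'a) set"
  assumes p: "1 \<le> p" and \<beta>: "0 < \<beta>" "\<beta> \<le> 1" and poincare: "poincare m mu p \<beta> \<Gamma>"
    and f [measurable]: "f \<in> borel_measurable borel" and fp: "(\<integral>\<^sup>+x. epow (f x) p \<partial>m) < \<infinity>"
    and \<rho> [measurable]: "\<rho> \<in> borel_measurable borel"
    and ug: "\<And>\<gamma>. \<gamma> \<in> \<Gamma> \<Longrightarrow> ug_ineq mu f \<rho> \<gamma>"
  defines "w \<equiv> \<lambda>x. epow (f x) p + enn_powr (\<rho> x) p"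
  obtains K where "0 \<le> K"
    and "\<And>l. 0 < l \<Longrightarrow> \<exists>u F. F \<in> sets borel \<and> (\<forall>x. \<bar>u x\<bar> \<le> K * l) \<and>
      (\<forall>x y. \<bar>u x - u y\<bar> \<le> K * l * dist x y powr \<beta>) \<and> (\<forall>x\<in>F. f x = ereal (u x)) \<and>
      emeasure m (- F) \<le> ennreal (K / l powr p) * (\<integral>\<^sup>+x. w x * indicator {x. ennreal (l powr p / 2) < w x} x \<partial>m)"
proof -
  note [measurable_cong] = sets_m
  obtain C lam where C: "0 < C" and lam: "1 \<le> lam"
    and P: "\<And>x r f \<rho>. r > 0 \<Longrightarrow> f \<in> borel_measurable (restrict_space m (ball x r)) \<Longrightarrow>
     (\<integral>\<^sup>+ y\<in>ball x r. e2ennreal \<bar>f y\<bar> \<partial>m) < \<infinity> \<Longrightarrow>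
     upper_gradient_in \<Gamma> mu f \<rho> (ball x r) \<Longrightarrow>
     (\<integral>\<^sup>+ y\<in>ball x r. epow (f y - ereal (ball_avg m (\<lambda>y. real_of_ereal (f y)) x r)) 1 \<partial>m) / emeasure m (ball x r)
       \<le> ennreal (C * diameter (ball x r) powr \<beta>) *
         enn_powr ((\<integral>\<^sup>+ y\<in>ball x (lam * r). enn_powr (\<rho> y) p \<partial>m) / emeasure m (ball x (lam * r))) (1 / p)"
    using poincare unfolding poincare_def Let_def ball_avg_def by blast
  have [measurable]: "w \<in> borel_measurable borel" unfolding w_def by measurable
  define g where "g x = real_of_ereal (f x)" for x
  have g [measurable]: "g \<in> borel_measurable borel" unfolding g_def by measurable
  have f1: "(\<integral>\<^sup>+ y\<in>ball x r. e2ennreal \<bar>f y\<bar> \<partial>m) \<le> ennreal (l * measure m (ball x r)) + ennreal (l powr (1 - p)) * (\<integral>\<^sup>+ y\<in>ball x r. epow (f y) p \<partial>m)"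
    if "0 < l" for x r l
  proof -
    have "(\<integral>\<^sup>+ y\<in>ball x r. e2ennreal \<bar>f y\<bar> \<partial>m)
        \<le> (\<integral>\<^sup>+ y. ennreal l * indicator (ball x r) y + ennreal (l powr (1 - p)) * (epow (f y) p * indicator (ball x r) y) \<partial>m)"
      using abs_le_level_plus_epow[OF p that]
      by (intro nn_integral_mono) (auto simp: indicator_def)
    also have "\<dots> = ennreal l * emeasure m (ball x r) + ennreal (l powr (1 - p)) * (\<integral>\<^sup>+ y\<in>ball x r. epow (f y) p \<partial>m)"
      by (simp add: nn_integral_add nn_integral_cmult nn_integral_cmult_indicator)
    also have "ennreal l * emeasure m (ball x r) = ennreal (l * measure m (ball x r))"
      unfolding emeasure_ball using that by (subst ennreal_mult) auto
    finally show ?thesis .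
  qed
  have fp_ball: "(\<integral>\<^sup>+ y\<in>ball x r. epow (f y) p \<partial>m) < \<infinity>" for x r
  proof -
    have "(\<integral>\<^sup>+ y\<in>ball x r. epow (f y) p \<partial>m) \<le> (\<integral>\<^sup>+ y. epow (f y) p \<partial>m)"
      by (intro nn_integral_mono) (auto simp: indicator_def)
    then show ?thesis using fp by simp
  qed
  have f1_fin: "(\<integral>\<^sup>+ y\<in>ball x r. e2ennreal \<bar>f y\<bar> \<partial>m) < \<infinity>" for x r
    using f1[of 1 x r] fp_ball[of x r] by (auto simp: le_less_trans)
  have g_le: "ennreal \<bar>g y\<bar> \<le> e2ennreal \<bar>f y\<bar>" for y
    by (cases "f y") (auto simp: g_def e2ennreal_ereal)
  have int: "set_integrable m (ball x r) g" for x r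
    unfolding set_integrable_def
  proof (rule integrableI_bounded)
    have "(\<integral>\<^sup>+ y. ennreal (norm (indicator (ball x r) y *\<^sub>R g y)) \<partial>m) \<le> (\<integral>\<^sup>+ y\<in>ball x r. e2ennreal \<bar>f y\<bar> \<partial>m)"
      using g_le by (intro nn_integral_mono) (auto simp: indicator_def)
    then show "(\<integral>\<^sup>+ y. ennreal (norm (indicator (ball x r) y *\<^sub>R g y)) \<partial>m) < \<infinity>"
      using f1_fin[of x r] by simp
  qed measurable
  obtain K1 where K1: "1 \<le> K1"
    and max: "\<And>w \<tau>. w \<in> borel_measurable borel \<Longrightarrow> 0 < \<tau> \<Longrightarrow> \<exists>F\<in>sets borel.
      emeasure m (- F) \<le> ennreal (K1 / \<tau>) * (\<integral>\<^sup>+x. w x * indicator {x. ennreal (\<tau> / 2) < w x} x \<partial>m) \<and>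
      (\<forall>x\<in>F. \<forall>i::nat. (\<integral>\<^sup>+y\<in>ball x (lam * (1/2)^i). w y \<partial>m)
         \<le> ennreal (K1 * \<tau> * measure m (ball x (lam * (1/2)^i))))"
    by (rule weak_type_maximal[of lam]) (use lam in auto)
  obtain K2 where K2: "0 \<le> K2"
    and camp: "\<And>g S A. g \<in> borel_measurable borel \<Longrightarrow> S \<in> sets borel \<Longrightarrow>
      (\<And>x r. set_integrable m (ball x r) g) \<Longrightarrow> 0 \<le> A \<Longrightarrow>
      (\<And>x i. x \<in> S \<Longrightarrow> (\<integral>\<^sup>+y\<in>ball x ((1/2)^i). ennreal \<bar>g y - ball_avg m g x ((1/2)^i)\<bar> \<partial>m)
         \<le> ennreal (A * ((1/2) powr \<beta>) ^ i * measure m (ball x ((1/2)^i)))) \<Longrightarrow>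
      (\<And>x. x \<in> S \<Longrightarrow> \<bar>ball_avg m g x 1\<bar> \<le> A) \<Longrightarrow>
      \<exists>u. (\<forall>x. \<bar>u x\<bar> \<le> K2 * A) \<and> (\<forall>x y. \<bar>u x - u y\<bar> \<le> K2 * A * dist x y powr \<beta>) \<and>
        (AE x in m. x \<in> S \<longrightarrow> g x = u x)"
    by (rule campanato[OF \<beta>]) blast
  obtain K3 where K3: "1 \<le> K3" "\<And>x y r s. 0 < r \<Longrightarrow> s + dist x y \<le> lam * r \<Longrightarrow> measure m (ball y s) \<le> K3 * measure m (ball x r)"
    using measure_ball_scale_le by blast
  \<comment> \<open>The first summand serves the oscillation estimate, with
    \<open>2 powr \<beta>\<close> from the diameter of a ball; the rest serves the averages at
    radius 1, with \<open>K3\<close> comparing \<open>ball x lam\<close> to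
    \<open>ball x 1\<close>.\<close>
  define K4 where "K4 = C * 2 powr \<beta> * K1 + 1 + K1 * K3"
  have K4: "0 \<le> K4" "C * 2 powr \<beta> * K1 \<le> K4" "1 + K1 * K3 \<le> K4"
    using C K1 K3(1) by (auto simp: K4_def)
  have main: "\<exists>u F. F \<in> sets borel \<and> (\<forall>x. \<bar>u x\<bar> \<le> K2 * K4 * l) \<and>
      (\<forall>x y. \<bar>u x - u y\<bar> \<le> K2 * K4 * l * dist x y powr \<beta>) \<and> (\<forall>x\<in>F. f x = ereal (u x)) \<and>
      emeasure m (- F) \<le> ennreal (K1 / l powr p) * (\<integral>\<^sup>+x. w x * indicator {x. ennreal (l powr p / 2) < w x} x \<partial>m)"
    if l: "0 < l" for l
  proof -
    obtain S where S [measurable]: "S \<in> sets borel"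
      and mS: "emeasure m (- S) \<le> ennreal (K1 / l powr p) * (\<integral>\<^sup>+x. w x * indicator {x. ennreal (l powr p / 2) < w x} x \<partial>m)"
      and wS: "\<And>x i. x \<in> S \<Longrightarrow> (\<integral>\<^sup>+y\<in>ball x (lam * (1/2)^i). w y \<partial>m)
         \<le> ennreal (K1 * l powr p * measure m (ball x (lam * (1/2)^i)))"
      using max[of w "l powr p"] l by auto
    have osc: "(\<integral>\<^sup>+y\<in>ball x ((1/2)^i). ennreal \<bar>g y - ball_avg m g x ((1/2)^i)\<bar> \<partial>m)
         \<le> ennreal (K4 * l * ((1/2) powr \<beta>) ^ i * measure m (ball x ((1/2)^i)))" if x: "x \<in> S" for x and i :: nat
    proof -
      define r where "r = (1/2 :: real) ^ i"
      have r: "0 < r" by (simp add: r_def)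
      have "(\<integral>\<^sup>+ y\<in>ball x (lam * r). enn_powr (\<rho> y) p \<partial>m) \<le> (\<integral>\<^sup>+y\<in>ball x (lam * r). w y \<partial>m)"
        by (intro nn_integral_mono mult_right_mono) (auto simp: w_def)
      also have "\<dots> \<le> ennreal (K1 * l powr p * measure m (ball x (lam * r)))"
        unfolding r_def by (rule wS[OF x])
      also have "\<dots> \<le> ennreal ((K1 * l) powr p * measure m (ball x (lam * r)))"
      proof (intro ennreal_leI mult_right_mono)
        \<comment> \<open>Since \<open>1 \<le> K1\<close> and \<open>1 \<le> p\<close>, the maximal
          constant may move inside the power, so that the gradient mean is at most
          \<open>K1 * l\<close> after taking the root.\<close>
        have "K1 \<le> K1 powr p" using powr_mono[of 1 p K1] p K1 by simp
        then show "K1 * l powr p \<le> (K1 * l) powr p"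
          using K1 l by (simp add: powr_mult mult_right_mono)
      qed simp
      finally have *: "(\<integral>\<^sup>+ y\<in>ball x (lam * r). enn_powr (\<rho> y) p \<partial>m) \<le> ennreal ((K1 * l) powr p * measure m (ball x (lam * r)))" .
      have "upper_gradient_in \<Gamma> mu f \<rho> (ball x r)"
        using ug by (simp add: upper_gradient_in_def)
      then have "(\<integral>\<^sup>+ y\<in>ball x r. epow (f y - ereal (ball_avg m (\<lambda>y. real_of_ereal (f y)) x r)) 1 \<partial>m) / emeasure m (ball x r)
       \<le> ennreal (C * diameter (ball x r) powr \<beta>) *
         enn_powr ((\<integral>\<^sup>+ y\<in>ball x (lam * r). enn_powr (\<rho> y) p \<partial>m) / emeasure m (ball x (lam * r))) (1 / p)"
        using r f1_fin by (intro P) (auto intro!: measurable_restrict_space1)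
      then have "(\<integral>\<^sup>+y\<in>ball x r. ennreal \<bar>g y - ball_avg m g x r\<bar> \<partial>m)
          \<le> ennreal (C * (2 * r) powr \<beta> * (K1 * l) * measure m (ball x r))"
        unfolding g_def using C \<beta> r lam p K1 l * by (intro oscillation_le_of_poincare) auto
      also have "\<dots> \<le> ennreal (K4 * l * ((1/2) powr \<beta>) ^ i * measure m (ball x r))"
      proof (intro ennreal_leI mult_right_mono)
        have "r powr \<beta> = ((1/2) powr real i) powr \<beta>"
          unfolding r_def by (subst powr_realpow) auto
        also have "\<dots> = ((1/2) powr \<beta>) powr real i" by (simp only: powr_powr mult.commute)
        also have "\<dots> = ((1/2) powr \<beta>) ^ i" by (intro powr_realpow) auto
        finally have "C * (2 * r) powr \<beta> * (K1 * l) = C * 2 powr \<beta> * K1 * (l * ((1/2) powr \<beta>) ^ i)"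
          using r by (simp add: powr_mult)
        also have "\<dots> \<le> K4 * (l * ((1/2) powr \<beta>) ^ i)"
          using l by (intro mult_right_mono K4) auto
        finally show "C * (2 * r) powr \<beta> * (K1 * l) \<le> K4 * l * ((1/2) powr \<beta>) ^ i" by (simp add: mult.assoc)
      qed simp
      finally show ?thesis by (simp add: r_def)
    qed
    have avg: "\<bar>ball_avg m g x 1\<bar> \<le> K4 * l" if x: "x \<in> S" for x
    proof -
      define M where "M = measure m (ball x 1)"
      have M: "measure m (ball x lam) \<le> K3 * M"
        unfolding M_def using lam by (intro K3) auto
      have "(\<integral>\<^sup>+y\<in>ball x 1. epow (f y) p \<partial>m) \<le> (\<integral>\<^sup>+y\<in>ball x (lam * (1/2) ^ 0). w y \<partial>m)"
        using lam by (intro nn_integral_mono) (auto simp: w_def indicator_def)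
      also have "\<dots> \<le> ennreal (K1 * l powr p * measure m (ball x lam))"
        using wS[OF x, of 0] by simp
      also have "\<dots> \<le> ennreal (K1 * l powr p * (K3 * M))"
        using K1 M by (intro ennreal_leI mult_left_mono) auto
      finally have *: "(\<integral>\<^sup>+y\<in>ball x 1. epow (f y) p \<partial>m) \<le> ennreal (K1 * l powr p * (K3 * M))" .
      have "(\<integral>\<^sup>+y\<in>ball x 1. ennreal \<bar>g y - 0\<bar> \<partial>m) \<le> (\<integral>\<^sup>+ y\<in>ball x 1. e2ennreal \<bar>f y\<bar> \<partial>m)"
        using g_le by (intro nn_integral_mono mult_right_mono) auto
      also have "\<dots> \<le> ennreal (l * M) + ennreal (l powr (1 - p)) * (\<integral>\<^sup>+ y\<in>ball x 1. epow (f y) p \<partial>m)"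
        unfolding M_def by (rule f1[OF l])
      also have "\<dots> \<le> ennreal (l * M) + ennreal (l powr (1 - p)) * ennreal (K1 * l powr p * (K3 * M))"
        by (intro add_left_mono mult_left_mono *) auto
      also have "\<dots> = ennreal (l * M + l powr (1 - p) * (K1 * l powr p * (K3 * M)))"
        using K1 K3(1) l by (simp add: M_def flip: ennreal_mult ennreal_plus)
      also have "l powr (1 - p) * (K1 * l powr p * (K3 * M)) = (l powr (1 - p) * l powr p) * (K1 * K3 * M)"
        by (simp add: mult_ac)
      also have "l powr (1 - p) * l powr p = l" using l by (simp flip: powr_add)
      also have "l * M + l * (K1 * K3 * M) = (1 + K1 * K3) * (l * M)" by (simp add: algebra_simps)
      also have "\<dots> \<le> K4 * (l * M)" using l by (intro mult_right_mono K4) (auto simp: M_def)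
      finally have "(\<integral>\<^sup>+y\<in>ball x 1. ennreal \<bar>g y - 0\<bar> \<partial>m) \<le> ennreal (K4 * l * M)"
        by (simp add: ennreal_leI mult.assoc)
      then have "\<bar>ball_avg m g x 1 - 0\<bar> \<le> K4 * l"
        using K4 l unfolding M_def by (intro ball_avg_diff_le int) auto
      then show ?thesis by simp
    qed
    obtain u where u: "\<And>x. \<bar>u x\<bar> \<le> K2 * (K4 * l)" "\<And>x y. \<bar>u x - u y\<bar> \<le> K2 * (K4 * l) * dist x y powr \<beta>"
      and ae: "AE x in m. x \<in> S \<longrightarrow> g x = u x"
      using camp[OF g S int _ osc avg] K4 l by auto
    have [measurable]: "u \<in> borel_measurable borel"
      using \<beta> u(2) by (intro borel_measurable_continuous_onI holder_imp_continuous)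
    \<comment> \<open>The null set where \<open>g\<close> and \<open>u\<close> differ or
      \<open>f\<close> is infinite is removed from \<open>S\<close>: arguments along paths require
      equality at every point of \<open>F\<close>.\<close>
    define F where "F = {x \<in> S. f x = ereal (u x)}"
    have F [measurable]: "F \<in> sets borel" unfolding F_def by measurable
    have "AE x in m. epow (f x) p \<noteq> \<infinity>"
      using fp by (intro nn_integral_PInf_AE) auto
    then have "AE x in m. x \<in> - F \<longrightarrow> x \<in> - S"
      using ae
    proof eventually_elim
      case (elim x)
      then have "\<bar>f x\<bar> \<noteq> \<infinity>" using epow_infinite[of "f x" p] by auto
      then show ?case using elim by (cases "f x") (auto simp: F_def g_def)
    qed
    then have "emeasure m (- F) \<le> emeasure m (- S)"
      by (intro emeasure_mono_AE) (auto simp: sets_m)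
    also note mS
    finally show ?thesis
      using F u by (intro exI[of _ u] exI[of _ F]) (auto simp: F_def mult.assoc)
  qed
  show ?thesis
  proof
    show "0 \<le> K1 + K2 * K4" using K1 K2 K4 by simp
    fix l :: real assume l: "0 < l"
    define T where "T = (\<integral>\<^sup>+x. w x * indicator {x. ennreal (l powr p / 2) < w x} x \<partial>m)"
    obtain u F where uF: "F \<in> sets borel" "\<And>x. \<bar>u x\<bar> \<le> K2 * K4 * l"
      "\<And>x y. \<bar>u x - u y\<bar> \<le> K2 * K4 * l * dist x y powr \<beta>" "\<And>x. x \<in> F \<Longrightarrow> f x = ereal (u x)"
      "emeasure m (- F) \<le> ennreal (K1 / l powr p) * T"
      using main[OF l] unfolding T_def by blast
    have le: "K2 * K4 * l \<le> (K1 + K2 * K4) * l" "K1 / l powr p \<le> (K1 + K2 * K4) / l powr p"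
      using K1 K2 K4 l by (auto intro!: mult_right_mono divide_right_mono)
    have "\<bar>u x\<bar> \<le> (K1 + K2 * K4) * l" for x
      using uF(2) le(1) by (rule order_trans)
    moreover have "\<bar>u x - u y\<bar> \<le> (K1 + K2 * K4) * l * dist x y powr \<beta>" for x y
      using uF(3)[of x y] mult_right_mono[OF le(1), of "dist x y powr \<beta>"] by simp
    moreover have "emeasure m (- F) \<le> ennreal ((K1 + K2 * K4) / l powr p) * T"
      using uF(5) mult_right_mono[OF ennreal_leI[OF le(2)], of T] by (meson order_trans zero_le)
    ultimately show "\<exists>u F. F \<in> sets borel \<and> (\<forall>x. \<bar>u x\<bar> \<le> (K1 + K2 * K4) * l) \<and>
      (\<forall>x y. \<bar>u x - u y\<bar> \<le> (K1 + K2 * K4) * l * dist x y powr \<beta>) \<and> (\<forall>x\<in>F. f x = ereal (u x)) \<and>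
      emeasure m (- F) \<le> ennreal ((K1 + K2 * K4) / l powr p) * (\<integral>\<^sup>+x. w x * indicator {x. ennreal (l powr p / 2) < w x} x \<partial>m)"
      using uF(1,4) unfolding T_def by blast
  qed
qed

end

section \<open>Weak upper gradients of the truncation and of the error\<close>

lemma Gamma_mu_image_pos:
  assumes "\<gamma> \<in> Gamma_mu mu" "0 \<le> a" "a < b" "b \<le> 1"
  shows "0 < emeasure mu (\<gamma> ` {a..b})"
  using assms by (auto simp: Gamma_mu_def simp flip: path_image_subpath')

lemma Gamma_mu_finite:
  assumes "\<gamma> \<in> Gamma_mu mu"
  shows "emeasure mu (path_image \<gamma>) < \<infinity>"
proof -
  have "subpath' 0 1 \<gamma> = \<gamma>" by (simp add: subpath'_def)
  moreover have "emeasure mu (path_image (subpath' a b \<gamma>)) < \<infinity>" if "0 \<le> a \<and> a < b \<and> b \<le> 1" for a b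
    using assms that by (auto simp: Gamma_mu_def)
  from this[of 0 1] have "emeasure mu (path_image (subpath' 0 1 \<gamma>)) < \<infinity>" by simp
  ultimately show ?thesis by simp
qed

text \<open>Non-trivial subpaths have positive \<open>mu\<close>-measure, so the image of no
  parameter interval is contained in \<open>N\<close>. Parameters avoiding \<open>N\<close>
  therefore accumulate at both ends, and continuity of \<open>u\<close> does the rest.\<close>

lemma endpoint_increment_le_of_dense:
  fixes mu :: "'a::metric_space measure" and u :: "'a \<Rightarrow> real"
  assumes mu: "sets mu = sets borel" and \<gamma>: "\<gamma> \<in> Gamma_mu mu"
    and N: "N \<in> sets borel" "emeasure mu (N \<inter> path_image \<gamma>) = 0"
    and u: "continuous_on UNIV u"
    and le: "\<And>a b. 0 \<le> a \<Longrightarrow> a < b \<Longrightarrow> b \<le> 1 \<Longrightarrow> \<gamma> a \<notin> N \<Longrightarrow> \<gamma> b \<notin> N \<Longrightarrow> ennreal \<bar>u (\<gamma> a) - u (\<gamma> b)\<bar> \<le> c"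
  shows "ennreal \<bar>u (pathstart \<gamma>) - u (pathfinish \<gamma>)\<bar> \<le> c"
proof -
  have arc: "arc \<gamma>" using \<gamma> by (simp add: Gamma_mu_def)
  have ex: "\<exists>t\<in>{a..b}. \<gamma> t \<notin> N" if "0 \<le> a" "a < b" "b \<le> 1" for a b
  proof (rule ccontr)
    assume "\<not> ?thesis"
    then have "\<gamma> ` {a..b} \<subseteq> N \<inter> path_image \<gamma>" using that by (auto simp: path_image_def)
    moreover have "N \<inter> path_image \<gamma> \<in> sets mu"
      using N(1) mu path_image_measurable[OF arc_imp_path[OF arc] mu] by auto
    ultimately have "emeasure mu (\<gamma> ` {a..b}) \<le> 0"
      unfolding N(2)[symmetric] by (rule emeasure_mono)
    then show False using Gamma_mu_image_pos[OF \<gamma> that] by simp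
  qed
  \<comment> \<open>At most \<open>1 / 3\<close>, which keeps the initial and the final parameter
    interval apart and gives \<open>a n < b n\<close>.\<close>
  define q where "q n = 1 / real (n + 3)" for n
  have q: "0 < q n" "q n < 1 - q n" for n by (auto simp: q_def field_simps)
  have q1: "q n < 1" for n using q[of n] by linarith
  have q0: "q \<longlonglongrightarrow> 0"
    unfolding q_def using LIMSEQ_ignore_initial_segment[OF lim_1_over_n, of 3] by simp
  have "\<exists>t\<in>{0..q n}. \<gamma> t \<notin> N" for n using q[of n] q1[of n] by (intro ex) auto
  then obtain a where a: "\<And>n. 0 \<le> a n" "\<And>n. a n \<le> q n" "\<And>n. \<gamma> (a n) \<notin> N" by (metis atLeastAtMost_iff)
  have "\<exists>t\<in>{1 - q n..1}. \<gamma> t \<notin> N" for n using q[of n] q1[of n] by (intro ex) auto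
  then obtain b where b: "\<And>n. 1 - q n \<le> b n" "\<And>n. b n \<le> 1" "\<And>n. \<gamma> (b n) \<notin> N" by (metis atLeastAtMost_iff)
  have ab: "a n < b n" for n using a(2)[of n] b(1)[of n] q(2)[of n] by linarith
  have cont: "continuous_on {0..1} (\<lambda>t. u (\<gamma> t))"
    using arc continuous_on_compose2[OF u, of "{0..1}" \<gamma>] by (auto simp: arc_def path_def)
  have "a \<longlonglongrightarrow> 0"
    by (rule tendsto_sandwich[OF _ _ tendsto_const q0]) (use a in auto)
  moreover have "b \<longlonglongrightarrow> 1"
  proof (rule tendsto_sandwich[OF _ _ _ tendsto_const])
    show "(\<lambda>n. 1 - q n) \<longlonglongrightarrow> 1" using tendsto_diff[OF tendsto_const[of 1] q0] by simp
  qed (use b in auto)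
  moreover have "a n \<in> {0..1}" "b n \<in> {0..1}" for n
    using a(1)[of n] b(2)[of n] ab[of n] by auto
  ultimately have "(\<lambda>n. u (\<gamma> (a n))) \<longlonglongrightarrow> u (\<gamma> 0)" "(\<lambda>n. u (\<gamma> (b n))) \<longlonglongrightarrow> u (\<gamma> 1)"
    using continuous_on_tendsto_compose[OF cont, of a 0 sequentially] continuous_on_tendsto_compose[OF cont, of b 1 sequentially]
    by (auto simp: always_eventually)
  then have "(\<lambda>n. ennreal \<bar>u (\<gamma> (a n)) - u (\<gamma> (b n))\<bar>) \<longlonglongrightarrow> ennreal \<bar>u (\<gamma> 0) - u (\<gamma> 1)\<bar>"
    by (intro tendsto_ennrealI tendsto_rabs tendsto_diff)
  then have "ennreal \<bar>u (\<gamma> 0) - u (\<gamma> 1)\<bar> \<le> c"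
  proof (rule LIMSEQ_le_const2, intro exI[of _ 0] allI impI)
    fix n show "ennreal \<bar>u (\<gamma> (a n)) - u (\<gamma> (b n))\<bar> \<le> c"
      using a b ab by (intro le) auto
  qed
  then show ?thesis by (simp add: pathstart_def pathfinish_def)
qed

text \<open>The arc-chord property gives \<open>u\<close> the constant upper gradient
  \<open>L * C\<close>, since endpoints are no further apart than the diameter of the image. Hence
  \<open>f - u\<close> has \<open>\<rho> + L * C\<close>, which may be cut off to \<open>- F\<close>
  because \<open>f - u\<close> vanishes on \<open>F\<close>; the increment of \<open>u\<close> is
  then split between \<open>f\<close> and \<open>f - u\<close>.\<close>

lemma truncation_weak_gradients:
  fixes mu m :: "'a::metric_space measure" and \<Gamma> :: "(real \<Rightarrow> 'a) set" and f :: "'a \<Rightarrow> ereal"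
  assumes mu: "sets mu = sets borel" and atom: "\<And>x. emeasure mu {x} = 0" and m: "sets m = sets borel"
    and p: "1 \<le> p" and \<beta>: "0 < \<beta>" and \<Gamma>: "\<Gamma> \<subseteq> Gamma_mu mu"
    and sub: "\<And>g u v. g \<in> \<Gamma> \<Longrightarrow> 0 \<le> u \<Longrightarrow> u < v \<Longrightarrow> v \<le> 1 \<Longrightarrow> subpath' u v g \<in> \<Gamma>"
    and C: "0 \<le> C" and chord: "\<And>\<gamma>. \<gamma> \<in> \<Gamma> \<Longrightarrow> ennreal (diameter (path_image \<gamma>) powr \<beta>) \<le> ennreal C * emeasure mu (path_image \<gamma>)"
    and f [measurable]: "f \<in> borel_measurable borel"
    and \<rho> [measurable]: "\<rho> \<in> borel_measurable borel" and \<rho>p: "(\<integral>\<^sup>+x. enn_powr (\<rho> x) p \<partial>m) < \<infinity>"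
    and ug: "\<And>\<gamma>. \<gamma> \<in> \<Gamma> \<Longrightarrow> ug_ineq mu f \<rho> \<gamma>" and \<rho>N: "\<And>x. \<bar>f x\<bar> = \<infinity> \<Longrightarrow> \<rho> x = \<infinity>"
    and L: "0 \<le> L" and hol: "\<And>x y. \<bar>u x - u y\<bar> \<le> L * dist x y powr \<beta>"
    and F [measurable]: "F \<in> sets borel" and eq: "\<And>x. x \<in> F \<Longrightarrow> f x = ereal (u x)"
  defines "\<sigma> \<equiv> \<lambda>x. (\<rho> x + ennreal (L * C)) * indicator (- F) x"
  shows "p_weak_ug m mu p \<Gamma> (\<lambda>x. f x - ereal (u x)) \<sigma>"
    and "p_weak_ug m mu p \<Gamma> (\<lambda>x. ereal (u x)) (\<lambda>x. \<rho> x + \<sigma> x)"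
proof -
  note [measurable_cong] = mu m
  define h where "h x = f x - ereal (u x)" for x
  define G where "G x = \<rho> x + ennreal (L * C)" for x
  have [measurable]: "G \<in> borel_measurable borel" unfolding G_def by measurable
  have [measurable]: "\<sigma> \<in> borel_measurable borel" unfolding \<sigma>_def by measurable
  have arc: "arc \<gamma>" if "\<gamma> \<in> \<Gamma>" for \<gamma> using \<Gamma> that by (auto simp: Gamma_mu_def)
  note imgs = path_image_measurable[OF arc_imp_path[OF arc] mu]
  have G_int: "line_int mu G \<gamma> = line_int mu \<rho> \<gamma> + ennreal (L * C) * emeasure mu (path_image \<gamma>)" if "\<gamma> \<in> \<Gamma>" for \<gamma>
  proof -
    note [measurable] = imgs[OF that]
    show ?thesis
      unfolding line_int_def G_def
      by (simp add: distrib_right nn_integral_add nn_integral_cmult_indicator)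
  qed
  have ug_u: "ennreal \<bar>u (pathstart \<gamma>) - u (pathfinish \<gamma>)\<bar> \<le> ennreal (L * C) * emeasure mu (path_image \<gamma>)"
    if \<gamma>: "\<gamma> \<in> \<Gamma>" for \<gamma>
  proof -
    have "bounded (path_image \<gamma>)" by (intro bounded_path_image arc_imp_path arc \<gamma>)
    then have "dist (pathstart \<gamma>) (pathfinish \<gamma>) \<le> diameter (path_image \<gamma>)"
      by (intro diameter_bounded_bound) auto
    then have "dist (pathstart \<gamma>) (pathfinish \<gamma>) powr \<beta> \<le> diameter (path_image \<gamma>) powr \<beta>"
      using \<beta> by (intro powr_mono2) auto
    then have "\<bar>u (pathstart \<gamma>) - u (pathfinish \<gamma>)\<bar> \<le> L * diameter (path_image \<gamma>) powr \<beta>"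
      using hol[of "pathstart \<gamma>" "pathfinish \<gamma>"] L by (meson mult_left_mono order_trans)
    then have "ennreal \<bar>u (pathstart \<gamma>) - u (pathfinish \<gamma>)\<bar> \<le> ennreal L * ennreal (diameter (path_image \<gamma>) powr \<beta>)"
      using L by (simp add: ennreal_leI flip: ennreal_mult)
    also have "\<dots> \<le> ennreal L * (ennreal C * emeasure mu (path_image \<gamma>))"
      by (intro mult_left_mono chord \<gamma>) auto
    finally show ?thesis using L C by (simp add: ennreal_mult mult.assoc)
  qed
  have hfin: "\<bar>h x\<bar> \<noteq> \<infinity> \<longleftrightarrow> \<bar>f x\<bar> \<noteq> \<infinity>" "\<bar>f x\<bar> \<noteq> \<infinity> \<Longrightarrow> real_of_ereal (h x) = real_of_ereal (f x) - u x" for x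
    by (cases "f x"; simp add: h_def)+
  have ug_h: "ug_ineq mu h G \<gamma>" if \<gamma>: "\<gamma> \<in> \<Gamma>" for \<gamma>
    unfolding ug_ineq_def
  proof (rule impI, elim conjE)
    let ?x = "pathstart \<gamma>" and ?y = "pathfinish \<gamma>"
    assume fin: "\<bar>h ?x\<bar> \<noteq> \<infinity>" "\<bar>h ?y\<bar> \<noteq> \<infinity>"
    then have fin': "\<bar>f ?x\<bar> \<noteq> \<infinity>" "\<bar>f ?y\<bar> \<noteq> \<infinity>" 
      using hfin(1)[of ?x] hfin(1)[of ?y] by auto
    have "\<bar>real_of_ereal (h ?x) - real_of_ereal (h ?y)\<bar>
        \<le> \<bar>real_of_ereal (f ?x) - real_of_ereal (f ?y)\<bar> + \<bar>u ?x - u ?y\<bar>"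
      using hfin(2)[OF fin'(1)] hfin(2)[OF fin'(2)] by linarith
    then have "ennreal \<bar>real_of_ereal (h ?x) - real_of_ereal (h ?y)\<bar>
        \<le> ennreal \<bar>real_of_ereal (f ?x) - real_of_ereal (f ?y)\<bar> + ennreal \<bar>u ?x - u ?y\<bar>"
      by (simp add: ennreal_leI flip: ennreal_plus)
    also have "\<dots> \<le> line_int mu G \<gamma>"
      unfolding G_int[OF \<gamma>] using ug[OF \<gamma>] fin' ug_u[OF \<gamma>] by (intro add_mono) (auto simp: ug_ineq_def)
    finally show "ennreal \<bar>real_of_ereal (h ?x) - real_of_ereal (h ?y)\<bar> \<le> line_int mu G \<gamma>" .
  qed
  have ug_h': "ug_ineq mu h \<sigma> \<gamma>" if \<gamma>: "\<gamma> \<in> \<Gamma>" and fin: "line_int mu \<rho> \<gamma> \<noteq> \<infinity>" for \<gamma>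
    unfolding \<sigma>_def G_def[symmetric]
  proof (rule arc_increment_off_zero_set[OF mu atom arc[OF \<gamma>]])
    have "emeasure mu (path_image \<gamma>) < \<infinity>"
      using \<Gamma> \<gamma> by (intro Gamma_mu_finite) auto
    then show "line_int mu G \<gamma> < \<infinity>"
      unfolding G_int[OF \<gamma>] using fin by (simp add: ennreal_mult_less_top top.not_eq_extremum)
    show "h x = 0" if "x \<in> F" for x using eq[OF that] by (simp add: h_def zero_ereal_def)
    show "ug_ineq mu h G (subpath' a b \<gamma>)" if "0 \<le> a" "a < b" "b \<le> 1" for a b
      by (intro ug_h sub \<gamma> that)
  qed measurable
  \<comment> \<open>The cut-off relies on dominated convergence along the arc and so on a finite
    integral; these paths are excepted for both conclusions.\<close>
  define \<Gamma>0 where "\<Gamma>0 = {\<gamma>\<in>\<Gamma>. line_int mu \<rho> \<gamma> = \<infinity>}"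
  have \<Gamma>0: "\<Gamma>0 \<subseteq> \<Gamma>" "modulus m mu p \<Gamma>0 = 0"
    unfolding \<Gamma>0_def using p arc arc_imp_path modulus_infinite_eq_0[OF _ mu m _ \<rho> \<rho>p, of \<Gamma>] by auto
  have "ug_ineq mu h \<sigma> \<gamma>" if "\<gamma> \<in> \<Gamma> - \<Gamma>0" for \<gamma>
    using that by (intro ug_h') (auto simp: \<Gamma>0_def)
  then show "p_weak_ug m mu p \<Gamma> (\<lambda>x. f x - ereal (u x)) \<sigma>"
    unfolding p_weak_ug_def h_def[symmetric] using \<Gamma>0 by (intro conjI exI[of _ \<Gamma>0]) auto
  have "ug_ineq mu (\<lambda>x. ereal (u x)) (\<lambda>x. \<rho> x + \<sigma> x) \<gamma>" if "\<gamma> \<in> \<Gamma> - \<Gamma>0" for \<gamma>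
  proof -
    have \<gamma>: "\<gamma> \<in> \<Gamma>" and fin: "line_int mu \<rho> \<gamma> \<noteq> \<infinity>" using that by (auto simp: \<Gamma>0_def)
    note [measurable] = imgs[OF \<gamma>]
    \<comment> \<open>At endpoints in \<open>N\<close> the inequalities for \<open>f\<close> and
      \<open>h\<close> are void. Since \<open>\<rho>\<close> is infinite on \<open>N\<close> and has
      finite integral along \<open>\<gamma>\<close>, the path meets \<open>N\<close> in a
      \<open>mu\<close>-null set.\<close>
    define N where "N = {x. \<bar>f x\<bar> = \<infinity>}"
    have N [measurable]: "N \<in> sets borel" unfolding N_def by measurable
    have "ennreal \<bar>u (pathstart \<gamma>) - u (pathfinish \<gamma>)\<bar> \<le> line_int mu (\<lambda>x. \<rho> x + \<sigma> x) \<gamma>"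
    proof (rule endpoint_increment_le_of_dense[OF mu _ N])
      show "\<gamma> \<in> Gamma_mu mu" using \<gamma> \<Gamma> by auto
      have "AE x in mu. \<rho> x * indicator (path_image \<gamma>) x \<noteq> \<infinity>"
        using fin by (intro nn_integral_PInf_AE) (auto simp: line_int_def)
      then have "AE x in mu. x \<notin> N \<inter> path_image \<gamma>"
        by eventually_elim (auto simp: N_def \<rho>N indicator_def)
      then show "emeasure mu (N \<inter> path_image \<gamma>) = 0"
        by (subst (asm) AE_iff_null_sets[symmetric]) (auto simp: mu intro: sets.Int)
      show "continuous_on UNIV u" using \<beta> hol by (rule holder_imp_continuous)
      fix a b assume ab: "0 \<le> a" "a < b" "b \<le> 1" "\<gamma> a \<notin> N" "\<gamma> b \<notin> N"
      let ?s = "subpath' a b \<gamma>"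
      have s: "?s \<in> \<Gamma>" by (intro sub \<gamma> ab)
      note [measurable] = imgs[OF s]
      have ends: "pathstart ?s = \<gamma> a" "pathfinish ?s = \<gamma> b"
        by (auto simp: subpath'_def pathstart_def pathfinish_def)
      have fab: "\<bar>f (\<gamma> a)\<bar> \<noteq> \<infinity>" "\<bar>f (\<gamma> b)\<bar> \<noteq> \<infinity>" using ab by (auto simp: N_def)
      then have hab: "\<bar>h (\<gamma> a)\<bar> \<noteq> \<infinity>" "\<bar>h (\<gamma> b)\<bar> \<noteq> \<infinity>"
        using hfin(1)[of "\<gamma> a"] hfin(1)[of "\<gamma> b"] by auto
      have "path_image ?s \<subseteq> path_image \<gamma>"
        using ab by (auto simp: path_image_subpath' path_image_def[of \<gamma>])
      then have mono: "line_int mu v ?s \<le> line_int mu v \<gamma>" for v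
        unfolding line_int_def
        by (intro nn_integral_mono mult_left_mono) (auto simp: indicator_def)
      have sfin: "line_int mu \<rho> ?s \<noteq> \<infinity>"
        using mono[of \<rho>] fin by (auto simp: top_unique)
      have "\<bar>u (\<gamma> a) - u (\<gamma> b)\<bar> \<le> \<bar>real_of_ereal (f (\<gamma> a)) - real_of_ereal (f (\<gamma> b))\<bar>
          + \<bar>real_of_ereal (h (\<gamma> a)) - real_of_ereal (h (\<gamma> b))\<bar>"
        using hfin(2)[OF fab(1)] hfin(2)[OF fab(2)] by linarith
      then have "ennreal \<bar>u (\<gamma> a) - u (\<gamma> b)\<bar> \<le> ennreal \<bar>real_of_ereal (f (\<gamma> a)) - real_of_ereal (f (\<gamma> b))\<bar>
          + ennreal \<bar>real_of_ereal (h (\<gamma> a)) - real_of_ereal (h (\<gamma> b))\<bar>"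
        by (simp add: ennreal_leI flip: ennreal_plus)
      also have "\<dots> \<le> line_int mu \<rho> ?s + line_int mu \<sigma> ?s"
        using ug[OF s] ug_h'[OF s sfin] fab hab unfolding ug_ineq_def ends
        by (intro add_mono) simp_all
      also have "\<dots> = line_int mu (\<lambda>x. \<rho> x + \<sigma> x) ?s"
        unfolding line_int_def by (simp add: distrib_right nn_integral_add)
      also have "\<dots> \<le> line_int mu (\<lambda>x. \<rho> x + \<sigma> x) \<gamma>" by (rule mono)
      finally show "ennreal \<bar>u (\<gamma> a) - u (\<gamma> b)\<bar> \<le> line_int mu (\<lambda>x. \<rho> x + \<sigma> x) \<gamma>" .
    qed
    then show ?thesis by (simp add: ug_ineq_def)
  qed
  then show "p_weak_ug m mu p \<Gamma> (\<lambda>x. ereal (u x)) (\<lambda>x. \<rho> x + \<sigma> x)"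
    unfolding p_weak_ug_def using \<Gamma>0 by (intro conjI exI[of _ \<Gamma>0]) auto
qed

section \<open>Norm estimates for the error and the choice of the level\<close>

lemma nn_integral_superlevel_tendsto_0:
  fixes w :: "'a \<Rightarrow> ennreal" and c :: "nat \<Rightarrow> real"
  assumes [measurable]: "w \<in> borel_measurable M" and fin: "(\<integral>\<^sup>+x. w x \<partial>M) < \<infinity>"
    and c: "filterlim c at_top sequentially"
  shows "(\<lambda>n. \<integral>\<^sup>+x. w x * indicator {x. ennreal (c n) < w x} x \<partial>M) \<longlonglongrightarrow> 0"
proof -
  have "(\<lambda>n. \<integral>\<^sup>+x. w x * indicator {x. ennreal (c n) < w x} x \<partial>M) \<longlonglongrightarrow> (\<integral>\<^sup>+x. 0 \<partial>M)"
  proof (rule nn_integral_dominated_convergence[where w = w])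
    show "AE x in M. w x * indicator {x. ennreal (c j) < w x} x \<le> w x" for j
      by (auto simp: indicator_def)
    have "AE x in M. w x \<noteq> \<infinity>"
      using fin by (intro nn_integral_PInf_AE) auto
    then show "AE x in M. (\<lambda>n. w x * indicator {x. ennreal (c n) < w x} x) \<longlonglongrightarrow> 0"
    proof eventually_elim
      case (elim x)
      then obtain a where a: "0 \<le> a" "w x = ennreal a" by (cases "w x") auto
      have "eventually (\<lambda>n. a \<le> c n) sequentially"
        using c by (simp add: filterlim_at_top)
      then show ?case
        by (intro tendsto_eventually) (elim eventually_mono, use a in \<open>auto simp: indicator_def ennreal_less_iff\<close>)
    qed
  qed (use fin in auto)
  then show ?thesis by simp
qed

lemma lp_le_of_support:
  assumes p: "1 \<le> p" and E [measurable]: "E \<in> sets m" and v [measurable]: "v \<in> borel_measurable m"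
    and b: "0 \<le> b"
  shows "(\<integral>\<^sup>+x. enn_powr ((v x + ennreal b) * indicator E x) p \<partial>m)
    \<le> ennreal (2 powr p) * ((\<integral>\<^sup>+x\<in>E. enn_powr (v x) p \<partial>m) + ennreal (b powr p) * emeasure m E)"
proof -
  have "(\<integral>\<^sup>+x. enn_powr ((v x + ennreal b) * indicator E x) p \<partial>m)
      \<le> (\<integral>\<^sup>+x. ennreal (2 powr p) * (enn_powr (v x) p * indicator E x + ennreal (b powr p) * indicator E x) \<partial>m)"
  proof (rule nn_integral_mono)
    fix x
    show "enn_powr ((v x + ennreal b) * indicator E x) p
        \<le> ennreal (2 powr p) * (enn_powr (v x) p * indicator E x + ennreal (b powr p) * indicator E x)"
      using enn_powr_add_le[of p "v x" "ennreal b"] p b by (auto simp: indicator_def enn_powr_ennreal)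
  qed
  also have "\<dots> = ennreal (2 powr p) * ((\<integral>\<^sup>+x\<in>E. enn_powr (v x) p \<partial>m) + ennreal (b powr p) * emeasure m E)"
    by (simp add: nn_integral_cmult nn_integral_add nn_integral_cmult_indicator)
  finally show ?thesis .
qed

lemma enn_powr_root_le:
  assumes "0 < p" "0 \<le> \<delta>" "x \<le> ennreal (\<delta> powr p)"
  shows "enn_powr x (1 / p) \<le> ennreal \<delta>"
proof -
  have "enn_powr x (1 / p) \<le> enn_powr (ennreal (\<delta> powr p)) (1 / p)"
    using assms by (intro enn_powr_mono) auto
  then show ?thesis using assms by (simp add: enn_powr_ennreal powr_powr)
qed

text \<open>A quantitative form of absolute continuity: with \<open>c\<close> half the threshold,
  both terms are controlled by the same tail integral of \<open>w\<close> that bounds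
  \<open>emeasure m (- F)\<close>.\<close>

lemma set_nn_integral_le_superlevel:
  assumes E [measurable]: "E \<in> sets m" and w [measurable]: "w \<in> borel_measurable m"
  shows "(\<integral>\<^sup>+x\<in>E. w x \<partial>m) \<le> (\<integral>\<^sup>+x. w x * indicator {x. c < w x} x \<partial>m) + c * emeasure m E"
proof -
  have "(\<integral>\<^sup>+x\<in>E. w x \<partial>m) \<le> (\<integral>\<^sup>+x. w x * indicator {x. c < w x} x + c * indicator E x \<partial>m)"
    by (intro nn_integral_mono) (auto simp: indicator_def not_less)
  also have "\<dots> = (\<integral>\<^sup>+x. w x * indicator {x. c < w x} x \<partial>m) + c * emeasure m E"
    by (simp add: nn_integral_add nn_integral_cmult_indicator)
  finally show ?thesis .
qed

lemma doubling_space_of_doubling: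
  assumes "sets m = sets borel" "doubling m"
  obtains C where "doubling_space m C"
proof -
  obtain C where C: "\<And>x r. 0 < r \<Longrightarrow> 0 < emeasure m (ball x (2 * r)) \<and>
      emeasure m (ball x (2 * r)) \<le> ennreal C * emeasure m (ball x r) \<and> emeasure m (ball x r) < \<infinity>"
    using assms(2) by (auto simp: doubling_def)
  have fin: "emeasure m (ball x r) < \<infinity>" for x r
    using C[of r x] by (cases "0 < r") (auto simp: not_less ball_empty)
  have eq: "emeasure m (ball x r) = ennreal (measure m (ball x r))" for x r
    using fin[of x r] by (intro emeasure_eq_ennreal_measure) (simp add: top.not_eq_extremum)
  show ?thesis
  proof (rule that, unfold_locales)
    show "sets m = sets borel" by (rule assms)
    show "emeasure m (ball x r) < \<infinity>" for x r by (rule fin)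
    fix x and r :: real assume r: "0 < r"
    \<comment> \<open>Positivity is part of the doubling condition for the doubled ball, hence the
      radius \<open>r / 2\<close>.\<close>
    have "0 < emeasure m (ball x (2 * (r / 2)))" using C[of "r / 2" x] r by simp
    then show "0 < measure m (ball x r)" by (simp add: eq)
    have "ennreal (measure m (ball x (2 * r))) \<le> ennreal C * ennreal (measure m (ball x r))"
      using C[OF r, of x] by (simp only: eq)
    \<comment> \<open>The sign of \<open>C\<close> is unknown, and \<open>ennreal\<close> sends
      negative numbers to 0; \<open>max C 0\<close> is the same constant as a real number.\<close>
    also have "\<dots> \<le> ennreal (max C 0) * ennreal (measure m (ball x r))"
      by (intro mult_right_mono ennreal_leI) auto
    also have "\<dots> = ennreal (max C 0 * measure m (ball x r))"
      by (simp add: ennreal_mult)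
    finally show "measure m (ball x (2 * r)) \<le> max C 0 * measure m (ball x r)"
      by (simp add: ennreal_le_iff)
  qed
qed

theorem theorem5p4:
  fixes mu m :: "'a::metric_space measure" and p \<beta> :: real and \<Gamma> :: "(real \<Rightarrow> 'a) set"
  assumes "sets mu = sets borel" and "\<forall>x. emeasure mu {x} = 0"
    and "sets m = sets borel" and "doubling m"
    and "1 \<le> p" and "0 < \<beta>" and "\<beta> \<le> 1"
    and "\<Gamma> \<subseteq> Gamma_mu mu"
    and "\<forall>g\<in>\<Gamma>. \<forall>u v. 0 \<le> u \<and> u < v \<and> v \<le> 1 \<longrightarrow> subpath' u v g \<in> \<Gamma>"
    and "\<forall>x y. x \<noteq> y \<longrightarrow> (\<exists>g\<in>\<Gamma>. (pathstart g = x \<and> pathfinish g = y) \<or> (pathstart g = y \<and> pathfinish g = x))"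
    and "poincare m mu p \<beta> \<Gamma>"
    and "arc_chord mu \<beta> \<Gamma>"
  shows "\<forall>f \<epsilon>. Ntilde m mu p \<Gamma> f \<and> \<epsilon> > 0 \<longrightarrow>
           (\<exists>u :: 'a \<Rightarrow> real. Ntilde m mu p \<Gamma> (\<lambda>x. ereal (u x)) \<and>
              (\<exists>L::real. \<forall>x y. \<bar>u x - u y\<bar> \<le> L * dist x y powr \<beta>) \<and>
              N_norm m mu p \<Gamma> (\<lambda>x. f x - ereal (u x)) < ennreal \<epsilon>)"
proof (intro allI impI, elim conjE)
  fix f :: "'a \<Rightarrow> ereal" and \<epsilon> :: real
  assume f_N: "Ntilde m mu p \<Gamma> f" and \<epsilon>: "\<epsilon> > 0"
  note mu = assms(1) and m = assms(3) and p = assms(5) and \<beta> = assms(6,7)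
  note [measurable_cong] = m
  have p0: "0 < p" using p by simp
  obtain Cd where "doubling_space m Cd"
    using doubling_space_of_doubling[OF m assms(4)] .
  then interpret doubling_space m Cd .
  obtain C where C: "0 < C" and chord: "\<And>\<gamma>. \<gamma> \<in> \<Gamma> \<Longrightarrow> ennreal (diameter (path_image \<gamma>) powr \<beta>) \<le> ennreal C * emeasure mu (path_image \<gamma>)"
    using assms(12) unfolding arc_chord_def by blast
  have f [measurable]: "f \<in> borel_measurable borel" and fp: "(\<integral>\<^sup>+ x. epow (f x) p \<partial>m) < \<infinity>"
    using f_N m by (auto simp: Ntilde_def cong: measurable_cong_sets)
  have path: "path \<gamma>" if "\<gamma> \<in> \<Gamma>" for \<gamma>
    using assms(8) that by (auto simp: Gamma_mu_def arc_imp_path)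
  have "AE x in m. epow (f x) p \<noteq> \<infinity>"
    using fp by (intro nn_integral_PInf_AE) auto
  then have "AE x in m. x \<notin> {x. \<bar>f x\<bar> = \<infinity>}"
    by eventually_elim (use epow_infinite in auto)
  then have null: "{x. \<bar>f x\<bar> = \<infinity>} \<in> null_sets m"
    by (subst AE_iff_null_sets) (auto simp: m)
  obtain \<rho>0 where "p_weak_ug m mu p \<Gamma> f \<rho>0" "(\<integral>\<^sup>+ x. enn_powr (\<rho>0 x) p \<partial>m) < \<infinity>"
    using f_N by (auto simp: Ntilde_def)
  then obtain \<rho> where \<rho> [measurable]: "\<rho> \<in> borel_measurable borel" and \<rho>p: "(\<integral>\<^sup>+ x. enn_powr (\<rho> x) p \<partial>m) < \<infinity>"
    and ug: "\<And>\<gamma>. \<gamma> \<in> \<Gamma> \<Longrightarrow> ug_ineq mu f \<rho> \<gamma>" and \<rho>N: "\<And>x. \<bar>f x\<bar> = \<infinity> \<Longrightarrow> \<rho> x = \<infinity>"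
    using p_weak_ug_imp_upper_gradient[OF p0 mu m path _ _ null, of \<Gamma> f \<rho>0] by auto
  define w where "w x = epow (f x) p + enn_powr (\<rho> x) p" for x
  have [measurable]: "w \<in> borel_measurable borel" unfolding w_def by measurable
  have wfin: "(\<integral>\<^sup>+ x. w x \<partial>m) < \<infinity>"
    using fp \<rho>p by (simp add: w_def nn_integral_add)
  define T where "T l = (\<integral>\<^sup>+x. w x * indicator {x. ennreal (l powr p / 2) < w x} x \<partial>m)" for l
  obtain K where K: "0 \<le> K" and trunc: "\<And>l. 0 < l \<Longrightarrow> \<exists>u F. F \<in> sets borel \<and> (\<forall>x. \<bar>u x\<bar> \<le> K * l) \<and>
      (\<forall>x y. \<bar>u x - u y\<bar> \<le> K * l * dist x y powr \<beta>) \<and> (\<forall>x\<in>F. f x = ereal (u x)) \<and>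
      emeasure m (- F) \<le> ennreal (K / l powr p) * T l"
    using lipschitz_truncation[OF p \<beta> assms(11) f fp \<rho> ug] unfolding T_def w_def by blast
  \<comment> \<open>Collects the factors of \<open>T l\<close>: \<open>2 powr p\<close> from
    splitting a sum, \<open>1 + K\<close> from integrating \<open>w\<close> over \<open>- F\<close>,
    and a term \<open>b powr p * K\<close> for each of the two constants added below,
    \<open>b = K\<close> for \<open>f - u\<close> and \<open>b = K * C\<close> for its
    gradient.\<close>
  define B where "B = 2 powr p * (1 + K + (K powr p + (K * C) powr p) * K)"
  have B: "0 \<le> B" using K by (simp add: B_def)
  have B_ge: "2 powr p * ((1 + K) + b * K) \<le> B" if "b = K powr p \<or> b = (K * C) powr p" for b
    unfolding B_def using that K by (intro mult_left_mono) (auto intro!: mult_right_mono add_mono)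
  \<comment> \<open>Chosen so that \<open>B * \<delta>\<close> is at most
    \<open>(\<epsilon> / 3) powr p\<close>; the added 1 keeps the denominator positive. Two norm
    terms of size \<open>\<epsilon> / 3\<close> leave the strict inequality.\<close>
  define \<delta> where "\<delta> = (\<epsilon> / 3) powr p / (B + 1)"
  have \<delta>: "0 < \<delta>" using \<epsilon> B by (simp add: \<delta>_def)
  have "filterlim (\<lambda>n. real (Suc n) powr p) at_top sequentially"
  proof (rule filterlim_at_top_mono[OF filterlim_real_sequentially], intro always_eventually allI)
    fix n
    have "real n \<le> real (Suc n) powr 1" by simp
    also have "\<dots> \<le> real (Suc n) powr p" using p by (intro powr_mono) auto
    finally show "real n \<le> real (Suc n) powr p" .
  qed
  then have "filterlim (\<lambda>n. (1 / 2) * (real (Suc n) powr p)) at_top sequentially"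
    by (intro filterlim_tendsto_pos_mult_at_top[OF tendsto_const]) auto
  then have "(\<lambda>n. T (real (Suc n))) \<longlonglongrightarrow> 0"
    unfolding T_def using wfin
    by (intro nn_integral_superlevel_tendsto_0) (auto simp: mult.commute)
  then have "eventually (\<lambda>n. T (real (Suc n)) < ennreal \<delta>) sequentially"
    using \<delta> by (intro order_tendstoD(2)) auto
  then obtain n where n: "T (real (Suc n)) < ennreal \<delta>"
    using eventually_happens' by (metis sequentially_bot)
  define l where "l = real (Suc n)"
  have l: "0 < l" by (simp add: l_def)
  obtain u F where F [measurable]: "F \<in> sets borel" and u: "\<And>x. \<bar>u x\<bar> \<le> K * l"
    and hol: "\<And>x y. \<bar>u x - u y\<bar> \<le> K * l * dist x y powr \<beta>" and eq: "\<And>x. x \<in> F \<Longrightarrow> f x = ereal (u x)"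
    and mF: "emeasure m (- F) \<le> ennreal (K / l powr p) * T l"
    using trunc[OF l] by blast
  have [measurable]: "u \<in> borel_measurable borel"
    using \<beta>(1) hol by (intro borel_measurable_continuous_onI holder_imp_continuous)
  define \<sigma> where "\<sigma> x = (\<rho> x + ennreal (K * l * C)) * indicator (- F) x" for x
  have [measurable]: "\<sigma> \<in> borel_measurable borel" unfolding \<sigma>_def by measurable
  have weak: "p_weak_ug m mu p \<Gamma> (\<lambda>x. f x - ereal (u x)) \<sigma>" "p_weak_ug m mu p \<Gamma> (\<lambda>x. ereal (u x)) (\<lambda>x. \<rho> x + \<sigma> x)"
    unfolding \<sigma>_def
    using assms(2,9) K l C p
    by (auto intro!: truncation_weak_gradients[OF mu _ m p \<beta>(1) assms(8) _ _ chord f \<rho> \<rho>p ug \<rho>N _ hol F eq])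
  \<comment> \<open>The growth of the constants with \<open>l\<close> is exactly compensated by the
    measure of \<open>- F\<close>: the powers of \<open>l\<close> cancel.\<close>
  have scale: "ennreal ((b * l) powr p) * emeasure m (- F) \<le> ennreal (b powr p * K) * T l" if "0 \<le> b" for b
  proof -
    have "ennreal ((b * l) powr p) * emeasure m (- F) \<le> ennreal ((b * l) powr p) * (ennreal (K / l powr p) * T l)"
      by (intro mult_left_mono mF) auto
    also have "\<dots> = ennreal ((b * l) powr p * (K / l powr p)) * T l"
      using K by (subst ennreal_mult) (auto simp: mult.assoc)
    also have "(b * l) powr p * (K / l powr p) = b powr p * K"
      using that l by (simp add: powr_mult)
    finally show ?thesis .
  qed
  have wF: "(\<integral>\<^sup>+x\<in>- F. w x \<partial>m) \<le> ennreal (1 + K) * T l"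
  proof -
    have "(\<integral>\<^sup>+x\<in>- F. w x \<partial>m) \<le> T l + ennreal (l powr p / 2) * emeasure m (- F)"
      unfolding T_def by (intro set_nn_integral_le_superlevel) auto
    also have "\<dots> \<le> T l + ennreal ((1 * l) powr p) * emeasure m (- F)"
      by (intro add_left_mono mult_right_mono ennreal_leI) auto
    also have "\<dots> \<le> T l + ennreal (1 powr p * K) * T l"
      by (intro add_left_mono scale) auto
    also have "\<dots> = ennreal (1 + K) * T l"
      using K by (simp add: distrib_right)
    finally show ?thesis .
  qed
  \<comment> \<open>Stated for general \<open>v\<close> because it is applied twice: to the absolute
    value of \<open>f\<close> with \<open>b = K\<close>, and to \<open>\<rho>\<close> with
    \<open>b = K * C\<close>.\<close>
  have bound: "(\<integral>\<^sup>+x. enn_powr ((v x + ennreal (b * l)) * indicator (- F) x) p \<partial>m) \<le> ennreal ((\<epsilon> / 3) powr p)"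
    if [measurable]: "v \<in> borel_measurable borel" and v: "\<And>x. enn_powr (v x) p \<le> w x" and b: "b = K \<or> b = K * C" for v b
  proof -
    have b0: "0 \<le> b" using b K C by auto
    have "(\<integral>\<^sup>+x. enn_powr ((v x + ennreal (b * l)) * indicator (- F) x) p \<partial>m)
        \<le> ennreal (2 powr p) * ((\<integral>\<^sup>+x\<in>- F. enn_powr (v x) p \<partial>m) + ennreal ((b * l) powr p) * emeasure m (- F))"
      using b0 l p by (intro lp_le_of_support) auto
    also have "\<dots> \<le> ennreal (2 powr p) * ((\<integral>\<^sup>+x\<in>- F. w x \<partial>m) + ennreal (b powr p * K) * T l)"
      using v b0 by (intro mult_left_mono add_mono scale nn_integral_mono mult_right_mono) auto
    also have "\<dots> \<le> ennreal (2 powr p) * (ennreal (1 + K) * T l + ennreal (b powr p * K) * T l)"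
      by (intro mult_left_mono add_right_mono wF) auto
    also have "\<dots> = ennreal (2 powr p * ((1 + K) + b powr p * K)) * T l"
    proof -
      have "ennreal (2 powr p * ((1 + K) + b powr p * K)) = ennreal (2 powr p) * (ennreal (1 + K) + ennreal (b powr p * K))"
        using K by (subst ennreal_plus[symmetric], simp, simp, subst ennreal_mult[symmetric]) auto
      then show ?thesis by (simp only: distrib_right mult.assoc)
    qed
    also have "\<dots> \<le> ennreal B * ennreal \<delta>"
      using b n by (intro mult_mono ennreal_leI B_ge) (auto simp: l_def)
    also have "\<dots> = ennreal (B * \<delta>)" using B \<delta> by (simp add: ennreal_mult)
    also have "\<dots> \<le> ennreal ((\<epsilon> / 3) powr p)"
      using B by (intro ennreal_leI) (simp add: \<delta>_def field_simps)
    finally show ?thesis .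
  qed
  have h: "epow (f x - ereal (u x)) p \<le> enn_powr ((e2ennreal \<bar>f x\<bar> + ennreal (K * l)) * indicator (- F) x) p" for x
  proof (cases "x \<in> F")
    case True
    then have "f x - ereal (u x) = ereal 0" using eq by simp
    then show ?thesis by (simp only: epow_ereal) simp
  next
    case False
    have "e2ennreal \<bar>f x - ereal (u x)\<bar> \<le> e2ennreal \<bar>f x\<bar> + ennreal (K * l)"
    proof (cases "f x")
      case (real a)
      have "\<bar>a - u x\<bar> \<le> \<bar>a\<bar> + K * l" using u[of x] by linarith
      then show ?thesis using real K l by (simp add: ennreal_leI flip: ennreal_plus)
    qed auto
    then show ?thesis using False p by (auto simp: epow_def intro!: enn_powr_mono)
  qed
  have hp: "(\<integral>\<^sup>+x. epow (f x - ereal (u x)) p \<partial>m) \<le> ennreal ((\<epsilon> / 3) powr p)"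
  proof -
    have "(\<integral>\<^sup>+x. epow (f x - ereal (u x)) p \<partial>m)
        \<le> (\<integral>\<^sup>+x. enn_powr ((e2ennreal \<bar>f x\<bar> + ennreal (K * l)) * indicator (- F) x) p \<partial>m)"
      by (intro nn_integral_mono h)
    also have "\<dots> \<le> ennreal ((\<epsilon> / 3) powr p)"
      by (rule bound) (auto simp: w_def epow_def)
    finally show ?thesis .
  qed
  have \<sigma>p: "(\<integral>\<^sup>+x. enn_powr (\<sigma> x) p \<partial>m) \<le> ennreal ((\<epsilon> / 3) powr p)"
    using bound[of \<rho> "K * C"] by (simp add: \<sigma>_def w_def mult_ac)
  have "lp_norm_e m p (\<lambda>x. f x - ereal (u x)) \<le> ennreal (\<epsilon> / 3)"
    unfolding lp_norm_e_def using hp \<epsilon> p by (intro enn_powr_root_le) auto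
  moreover have "(INF \<rho> \<in> {\<rho>. p_weak_ug m mu p \<Gamma> (\<lambda>x. f x - ereal (u x)) \<rho>}. lp_norm_n m p \<rho>) \<le> ennreal (\<epsilon> / 3)"
  proof (rule INF_lower2)
    show "\<sigma> \<in> {\<rho>. p_weak_ug m mu p \<Gamma> (\<lambda>x. f x - ereal (u x)) \<rho>}" using weak by simp
    show "lp_norm_n m p \<sigma> \<le> ennreal (\<epsilon> / 3)"
      unfolding lp_norm_n_def using \<sigma>p \<epsilon> p by (intro enn_powr_root_le) auto
  qed
  ultimately have "N_norm m mu p \<Gamma> (\<lambda>x. f x - ereal (u x)) \<le> ennreal (\<epsilon> / 3) + ennreal (\<epsilon> / 3)"
    unfolding N_norm_def by (rule add_mono)
  also have "\<dots> < ennreal \<epsilon>"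
    using \<epsilon> by (simp add: ennreal_less_iff flip: ennreal_plus)
  finally have norm: "N_norm m mu p \<Gamma> (\<lambda>x. f x - ereal (u x)) < ennreal \<epsilon>" .
  \<comment> \<open>Boundedness of \<open>u\<close> gives no integrability on a space of infinite
    measure; \<open>u\<close> inherits it from \<open>f\<close> and \<open>f - u\<close>, and its
    gradient from \<open>\<rho>\<close> and \<open>\<sigma>\<close>.\<close>
  have "Ntilde m mu p \<Gamma> (\<lambda>x. ereal (u x))"
    unfolding Ntilde_def
  proof (intro conjI exI[of _ "\<lambda>x. \<rho> x + \<sigma> x"] weak)
    show "(\<lambda>x. ereal (u x)) \<in> borel_measurable m" by measurable
    have "(\<integral>\<^sup>+x. epow (ereal (u x)) p \<partial>m)
        \<le> (\<integral>\<^sup>+x. ennreal (2 powr p) * (epow (f x) p + epow (f x - ereal (u x)) p) \<partial>m)"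
      using p by (intro nn_integral_mono epow_le_diff) auto
    also have "\<dots> = ennreal (2 powr p) * ((\<integral>\<^sup>+x. epow (f x) p \<partial>m) + (\<integral>\<^sup>+x. epow (f x - ereal (u x)) p \<partial>m))"
      by (simp add: nn_integral_cmult nn_integral_add)
    also have "\<dots> < \<infinity>"
      using fp le_less_trans[OF hp] by (simp add: ennreal_mult_less_top)
    finally show "(\<integral>\<^sup>+x. epow (ereal (u x)) p \<partial>m) < \<infinity>" .
    have "(\<integral>\<^sup>+x. enn_powr (\<rho> x + \<sigma> x) p \<partial>m)
        \<le> (\<integral>\<^sup>+x. ennreal (2 powr p) * (enn_powr (\<rho> x) p + enn_powr (\<sigma> x) p) \<partial>m)"
      using p by (intro nn_integral_mono enn_powr_add_le) auto
    also have "\<dots> = ennreal (2 powr p) * ((\<integral>\<^sup>+x. enn_powr (\<rho> x) p \<partial>m) + (\<integral>\<^sup>+x. enn_powr (\<sigma> x) p \<partial>m))"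
      by (simp add: nn_integral_cmult nn_integral_add)
    also have "\<dots> < \<infinity>"
      using \<rho>p le_less_trans[OF \<sigma>p] by (simp add: ennreal_mult_less_top)
    finally show "(\<integral>\<^sup>+x. enn_powr (\<rho> x + \<sigma> x) p \<partial>m) < \<infinity>" .
  qed
  then show "\<exists>u :: 'a \<Rightarrow> real. Ntilde m mu p \<Gamma> (\<lambda>x. ereal (u x)) \<and>
              (\<exists>L::real. \<forall>x y. \<bar>u x - u y\<bar> \<le> L * dist x y powr \<beta>) \<and>
              N_norm m mu p \<Gamma> (\<lambda>x. f x - ereal (u x)) < ennreal \<epsilon>"
    using hol norm by blast
qed

end
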